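(* Let $G$ be a $3$-$\gamma$-vertex-critical graph. (1) If $G$ is $K_{1,6}$-free, $|V(G)|$ is even and $|V(G)|\neq 12$, then $G$ has a perfect matching. (2) If $G$ is $K_{1,7}$-free, $|V(G)|$ is odd, $c_o(G)=1$ and $|V(G)|\neq 13$, then either $G$ has a near perfect matching or $G$ is isomorphic to one of the three graphs $A$, $B_1$, $B_2$ described in the context.
   Context: All graphs are finite and simple. A set $S\subseteq V(G)$ is a dominating set of $G$ if every vertex of $G$ is in $S$ or is adjacent to a vertex of $S$; the domination number $\gamma(G)$ is the minimum cardinality of a dominating set. $G$ is $3$-$\gamma$-vertex-critical if $\gamma(G)=3$ and $\gamma(G-v)<\gamma(G)$ for every vertex $v\in V(G)$. $G$ is $K_{1,r}$-free if it has no induced subgraph isomorphic to the star $K_{1,r}$. $c_o(G)$ denotes the number of connected components of $G$ with an odd number of vertices. A matching is perfect if it is incident with every vertex of $G$; it is near perfect if it is incident with all vertices of $G$ except exactly one. The three exceptional graphs are: Graph $A$ ($9$ vertices): the vertex set is $\{u,v,w,c_1,c_2,c_3,c_4,c_5,c_6\}$; both $\{u,v,w\}$ and $\{c_1,\dots,c_6\}$ are independent sets; $u$ is adjacent exactly to $c_3,c_4,c_5,c_6$; $v$ is adjacent exactly to $c_1,c_2,c_5,c_6$; $w$ is adjacent exactly to $c_1,c_2,c_3,c_4$. Graphs $B_1$ and $B_2$ ($15$ vertices each): the vertex set is the disjoint union of a set $S$ with $|S|=6$ and an independent set $I$ with $|I|=9$. The subgraph induced on $S$ is $3$-regular: it is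 $K_{3,3}$ for $B_1$, and the triangular prism (the complement of the $6$-cycle $C_6$) for $B_2$. For each $s\in S$ let $P_s\subseteq S$ be the set of the two vertices of $S\setminus\{s\}$ not adjacent to $s$; the six $2$-subsets $P_s$ $(s\in S)$ are pairwise distinct. The vertices of $I$ are in bijection with the remaining $\binom{6}{2}-6=9$ two-element subsets of $S$, and the vertex of $I$ corresponding to the subset $P$ is adjacent exactly to the four vertices of $S\setminus P$. *)

theory Defs
  imports "Graph_Theory.Graph_Theory"
begin

text \<open>
  Finite simple graphs are the graphs of the locale \<^locale>\<open>graph\<close>: finite, loop-free, symmetric
  digraphs without parallel arcs.  Each undirected edge is thus a pair of opposite arcs.  The
  library notation \<open>u \<rightarrow>\<^bsub>G\<^esub> v\<close> denotes adjacency.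
\<close>

definition dominating_set :: "('a, 'b) pre_digraph \<Rightarrow> 'a set \<Rightarrow> bool" where
  "dominating_set G S \<longleftrightarrow>
     S \<subseteq> verts G \<and> (\<forall>v\<in>verts G. v \<in> S \<or> (\<exists>u\<in>S. v \<rightarrow>\<^bsub>G\<^esub> u))"

definition domination_number :: "('a, 'b) pre_digraph \<Rightarrow> nat" where
  "domination_number G = Min (card ` {S. dominating_set G S})"

definition gamma_vertex_critical :: "nat \<Rightarrow> ('a, 'b) pre_digraph \<Rightarrow> bool" where
  "gamma_vertex_critical k G \<longleftrightarrow>
     domination_number G = k \<and>
     (\<forall>v\<in>verts G. domination_number (pre_digraph.del_vert G v) < domination_number G)"

definition star_free :: "nat \<Rightarrow> ('a, 'b) pre_digraph \<Rightarrow> bool" where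
  "star_free r G \<longleftrightarrow> \<not> (\<exists>H. induced_subgraph H G \<and> complete_bipartite_digraph 1 r H)"

text \<open>Connected components are the maximal connected subgraphs; these are never empty.\<close>

definition components :: "('a, 'b) pre_digraph \<Rightarrow> ('a, 'b) pre_digraph set" where
  "components G = {C. pre_digraph.max_subgraph G connected C}"

definition num_odd_components :: "('a, 'b) pre_digraph \<Rightarrow> nat" where
  "num_odd_components G = card {C \<in> components G. odd (card (verts C))}"

text \<open>Undirected edges are represented by their sets of two end vertices.\<close>

definition matching :: "('a, 'b) pre_digraph \<Rightarrow> 'a set set \<Rightarrow> bool" where
  "matching G M \<longleftrightarrow> M \<subseteq> {{u, v} | u v. u \<rightarrow>\<^bsub>G\<^esub> v} \<and> pairwise disjnt M"

definition perfect_matching :: "('a, 'b) pre_digraph \<Rightarrow> 'a set set \<Rightarrow> bool" where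
  "perfect_matching G M \<longleftrightarrow> matching G M \<and> \<Union> M = verts G"

definition near_perfect_matching :: "('a, 'b) pre_digraph \<Rightarrow> 'a set set \<Rightarrow> bool" where
  "near_perfect_matching G M \<longleftrightarrow> matching G M \<and> (\<exists>v\<in>verts G. \<Union> M = verts G - {v})"

datatype vertex_A = U | V | W | C1 | C2 | C3 | C4 | C5 | C6

definition graph_A :: "vertex_A pair_pre_digraph" where
  "graph_A =
     (let E = {U} \<times> {C3, C4, C5, C6} \<union> {V} \<times> {C1, C2, C5, C6} \<union> {W} \<times> {C1, C2, C3, C4}
      in \<lparr> pverts = {U, V, W, C1, C2, C3, C4, C5, C6}, parcs = E \<union> E\<inverse> \<rparr>)"

definition K33 :: "nat pair_pre_digraph" where
  "K33 = \<lparr> pverts = {0..<6}, parcs = {0..<3} \<times> {3..<6} \<union> {3..<6} \<times> {0..<3} \<rparr>"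

text \<open>The triangular prism, as the complement of the cycle \<open>0, 1, 2, 3, 4, 5\<close>.\<close>

definition prism :: "nat pair_pre_digraph" where
  "prism = \<lparr> pverts = {0..<6},
     parcs = {(i, j). i < 6 \<and> j < 6 \<and> i \<noteq> j \<and> j \<noteq> (i + 1) mod 6 \<and> i \<noteq> (j + 1) mod 6} \<rparr>"

text \<open>\<open>non_neighbours H s\<close> is the set \<open>P\<^sub>s\<close>.\<close>

definition non_neighbours :: "'a pair_pre_digraph \<Rightarrow> 'a \<Rightarrow> 'a set" where
  "non_neighbours H s = {t \<in> pverts H. t \<noteq> s \<and> (s, t) \<notin> parcs H}"

definition remaining_pairs :: "'a pair_pre_digraph \<Rightarrow> 'a set set" where
  "remaining_pairs H =
     {P. P \<subseteq> pverts H \<and> card P = 2} - non_neighbours H ` pverts H"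

text \<open>
  \<open>graph_B H\<close> is the graph with \<open>S\<close> inducing \<open>H\<close> (left summand) and with \<open>I\<close> the set of remaining
  pairs (right summand).
\<close>

definition graph_B :: "'a pair_pre_digraph \<Rightarrow> ('a + 'a set) pair_pre_digraph" where
  "graph_B H =
     (let E = {(Inl s, Inr P) | s P. P \<in> remaining_pairs H \<and> s \<in> pverts H - P}
      in \<lparr> pverts = Inl ` pverts H \<union> Inr ` remaining_pairs H,
           parcs = {(Inl s, Inl t) | s t. (s, t) \<in> parcs H} \<union> E \<union> E\<inverse> \<rparr>)"

definition graph_B1 :: "(nat + nat set) pair_pre_digraph" where
  "graph_B1 = graph_B K33"

definition graph_B2 :: "(nat + nat set) pair_pre_digraph" where
  "graph_B2 = graph_B prism"

end

theory Submission
  imports Defs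
begin

text \<open>
  Suppose there is no (near) perfect matching.  The Tutte--Berge formula gives a set \<open>S\<close> of \<open>s\<close>
  vertices such that \<open>G - S\<close> has at least \<open>s + 2\<close> (in the odd case \<open>s + 3\<close>) odd components.  By
  criticality each vertex \<open>v\<close> has a pair \<open>D v\<close> that dominates \<open>G - v\<close> and misses \<open>v\<close>, so the two
  non-neighbourhoods of \<open>D v\<close> meet exactly in \<open>v\<close>; in particular \<open>D\<close> is injective.  If \<open>D v\<close>
  has exactly one member \<open>x\<close> in \<open>S\<close>, then up to \<open>v\<close> all vertices outside \<open>S\<close> not adjacent to \<open>x\<close>
  lie in one component.  This makes \<open>x\<close> useful for few vertices and, against star-freeness, for none
  at all once \<open>s \<ge> 6\<close>; then \<open>D\<close> embeds the vertex set into the pairs in \<open>S\<close>.  Counting pairs and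
  components for each \<open>s\<close> leaves only \<open>s = 3\<close> with nine vertices and \<open>s = 6\<close> with fifteen, where all
  adjacencies are forced.
\<close>

section \<open>The Tutte--Berge formula\<close>

text \<open>Both parts are one argument with \<open>p = 5\<close> or \<open>p = 6\<close>: the graph
  is \<open>K_{1,p+1}\<close>-free and \<open>G - S\<close> has \<open>m >= s + p - 3\<close>
  components. A vertex of \<open>S\<close> has neighbours in at most \<open>p\<close> components,
  since one neighbour from each would give the leaves of an induced star; so it misses at least
  \<open>s - 3\<close> components entirely. A vertex that is the only member in \<open>S\<close> of
  some \<open>D v\<close> can miss at most two. This makes \<open>s = 6\<close> the threshold and
  \<open>s = 5\<close> the delicate case: the excluded orders 12 and 13 are
  \<open>p + 7 = 5 + (p + 2)\<close>, the order when \<open>m = p + 2\<close> and every component is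
  a single vertex. For large \<open>s\<close> the bound \<open>n <= s choose 2\<close> on the order
  \<open>n\<close> is too weak. There the two members of a \<open>D v\<close> miss almost disjoint
  sets of components: a triangle formed by such pairs bounds \<open>m\<close>, and without a
  triangle Mantel's theorem bounds \<open>n\<close>. The assumption
  \<open>num_odd_components G = 1\<close> keeps \<open>S\<close> from being empty in the odd
  case.\<close>

definition reach_class :: "'a rel \<Rightarrow> 'a set \<Rightarrow> 'a \<Rightarrow> 'a set" where
  "reach_class E X u = {v \<in> X. (u, v) \<in> (Restr E X)\<^sup>*}"

definition odd_classes :: "'a rel \<Rightarrow> 'a set \<Rightarrow> 'a set set" where
  "odd_classes E X = {C \<in> reach_class E X ` X. odd (card C)}"

text \<open>The graph is a relation restricted to a vertex set, so that an induction can delete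
  vertices while keeping the relation.\<close>

definition set_matching :: "'a rel \<Rightarrow> 'a set \<Rightarrow> 'a set set \<Rightarrow> bool" where
  "set_matching E X M \<longleftrightarrow>
     M \<subseteq> {{u, v} | u v. (u, v) \<in> E \<and> u \<in> X \<and> v \<in> X} \<and> pairwise disjnt M"

definition max_matching :: "'a rel \<Rightarrow> 'a set \<Rightarrow> 'a set set \<Rightarrow> bool" where
  "max_matching E X M \<longleftrightarrow>
     set_matching E X M \<and> (\<forall>N. set_matching E X N \<longrightarrow> card N \<le> card M)"

lemma reach_class_refl: "u \<in> X \<Longrightarrow> u \<in> reach_class E X u"
  by (simp add: reach_class_def)

lemma reach_class_eq:
  assumes "sym E" "v \<in> reach_class E X u" "u \<in> X"
  shows "reach_class E X v = reach_class E X u"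
proof -
  have "sym ((Restr E X)\<^sup>*)"
    using assms(1) by (intro sym_rtrancl) (auto simp: sym_def)
  then show ?thesis
    using assms unfolding reach_class_def sym_def by (blast intro: rtrancl_trans)
qed

lemma reach_class_edge:
  assumes "(u, v) \<in> E" "u \<in> X" "v \<in> X" "sym E"
  shows "reach_class E X u = reach_class E X v"
  using assms by (intro reach_class_eq[symmetric]) (auto simp: reach_class_def)

lemma set_matching_finite: "finite X \<Longrightarrow> set_matching E X M \<Longrightarrow> finite M"
  unfolding set_matching_def
  by (rule finite_subset[of _ "Pow X"]) auto

lemma card_Union_pairs:
  assumes "finite M" "pairwise disjnt M" "\<And>e. e \<in> M \<Longrightarrow> card e = 2"
  shows "card (\<Union>M) = 2 * card M"
proof -
  have "card (\<Union>M) = sum card M"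
    using assms by (intro card_Union_disjoint) (auto intro: card_ge_0_finite)
  then show ?thesis using assms by simp
qed

lemma set_matching_card_edge:
  assumes "irrefl E" "set_matching E X M" "e \<in> M"
  shows "card e = 2"
proof -
  obtain u v where "e = {u, v}" "(u, v) \<in> E"
    using assms unfolding set_matching_def by blast
  then show ?thesis using assms(1) by (auto simp: irrefl_def card_insert_if)
qed

lemma set_matching_Union_subset: "set_matching E X M \<Longrightarrow> \<Union>M \<subseteq> X"
  unfolding set_matching_def by blast

lemma set_matching_card:
  assumes "finite X" "irrefl E" "set_matching E X M"
  shows "card (\<Union>M) = 2 * card M" "card X = 2 * card M + card (X - \<Union>M)"
proof -
  show *: "card (\<Union>M) = 2 * card M"
    using assms by (intro card_Union_pairs)
      (auto simp: set_matching_def intro: set_matching_finite set_matching_card_edge)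
  have "card (X - \<Union>M) = card X - card (\<Union>M)" "card (\<Union>M) \<le> card X"
    using assms set_matching_Union_subset[OF assms(3)]
    by (auto intro: card_Diff_subset card_mono finite_subset)
  then show "card X = 2 * card M + card (X - \<Union>M)" using * by simp
qed

lemma set_matching_insert:
  assumes "set_matching E X M" "(u, v) \<in> E" "u \<in> X" "v \<in> X" "u \<notin> \<Union>M" "v \<notin> \<Union>M"
  shows "set_matching E X (insert {u, v} M)"
  using assms unfolding set_matching_def
  by (auto simp: pairwise_insert disjnt_def)

lemma set_matching_subset: "set_matching E X M \<Longrightarrow> N \<subseteq> M \<Longrightarrow> set_matching E X N"
  unfolding set_matching_def by (auto intro: pairwise_subset)

lemma set_matching_mono:
  assumes "set_matching E X M" "X \<subseteq> Y"
  shows "set_matching E Y M"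
proof -
  have "{{u, v} | u v. (u, v) \<in> E \<and> u \<in> X \<and> v \<in> X} \<subseteq> {{u, v} | u v. (u, v) \<in> E \<and> u \<in> Y \<and> v \<in> Y}"
    using assms(2) by blast
  then show ?thesis using assms(1) unfolding set_matching_def by (meson subset_trans)
qed

lemma set_matching_unique:
  "set_matching E X M \<Longrightarrow> e \<in> M \<Longrightarrow> g \<in> M \<Longrightarrow> x \<in> e \<Longrightarrow> x \<in> g \<Longrightarrow> e = g"
  unfolding set_matching_def pairwise_def disjnt_iff by blast

lemma max_matching_exists:
  assumes "finite X"
  shows "\<exists>M. max_matching E X M"
proof -
  let ?A = "{M. set_matching E X M}"
  have fin: "finite ?A"
    using assms by (intro finite_subset[of ?A "Pow (Pow X)"]) (auto simp: set_matching_def)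
  have "{} \<in> ?A" by (simp add: set_matching_def)
  then obtain M where "M \<in> ?A" "card M = Max (card ` ?A)"
    using Max_in[of "card ` ?A"] fin by (auto simp: image_iff) (metis)
  then show ?thesis
    unfolding max_matching_def using fin by auto
qed

lemma max_matching_no_edge:
  assumes "finite X" "max_matching E X M" "(u, v) \<in> E" "u \<in> X" "v \<in> X" "u \<notin> \<Union>M" "v \<notin> \<Union>M"
  shows False
proof -
  have M: "set_matching E X M" using assms by (simp add: max_matching_def)
  have "set_matching E X (insert {u, v} M)" using assms M by (intro set_matching_insert)
  then have "card (insert {u, v} M) \<le> card M" using assms(2) by (simp add: max_matching_def)
  moreover have "{u, v} \<notin> M" using assms by auto
  ultimately show False using set_matching_finite[OF assms(1) M] by simp
qed

section \<open>Gallai's lemma and the induction for the Tutte--Berge formula\<close>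

definition jointly_covered :: "'a rel \<Rightarrow> 'a set \<Rightarrow> 'a \<Rightarrow> 'a \<Rightarrow> bool" where
  "jointly_covered E X u v \<longleftrightarrow>
     u = v \<or> \<not> (\<exists>M. max_matching E X M \<and> u \<notin> \<Union>M \<and> v \<notin> \<Union>M)"

text \<open>
  Gallai's lemma.  If \<open>M\<close> avoids \<open>u\<close> and \<open>v\<close>, take a maximum matching \<open>N\<close> avoiding \<open>t\<close> that shares
  as many edges as possible with \<open>M\<close>; exchanging one edge of \<open>N\<close> for one of \<open>M\<close> increases that number.
\<close>

lemma jointly_covered_trans:
  assumes fin: "finite X" and E: "sym E" "irrefl E"
    and X: "u \<in> X" "t \<in> X" "v \<in> X"
    and avoid: "\<exists>N. max_matching E X N \<and> t \<notin> \<Union>N"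
    and ut: "jointly_covered E X u t" and tv: "jointly_covered E X t v"
  shows "jointly_covered E X u v"
proof (rule ccontr)
  assume "\<not> jointly_covered E X u v"
  then obtain M where uv: "u \<noteq> v" and M: "max_matching E X M" "u \<notin> \<Union>M" "v \<notin> \<Union>M"
    by (auto simp: jointly_covered_def)
  have ut': "u \<noteq> t" and tv': "t \<noteq> v"
    using ut tv uv M by (auto simp: jointly_covered_def)
  have tM: "t \<in> \<Union>M" using ut ut' M by (auto simp: jointly_covered_def)
  let ?P = "\<lambda>N. max_matching E X N \<and> t \<notin> \<Union>N"
  have finM: "finite M" using fin M set_matching_finite by (auto simp: max_matching_def)
  have "\<exists>N. ?P N \<and> (\<forall>N'. ?P N' \<longrightarrow> card (M \<inter> N') \<le> card (M \<inter> N))"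
  proof -
    obtain N where "?P N" using avoid by blast
    then show ?thesis
      using ex_has_greatest_nat[of ?P N "\<lambda>N. card (M \<inter> N)" "Suc (card M)"] finM
      by (auto simp: less_Suc_eq_le intro: card_mono)
  qed
  then obtain N where N: "max_matching E X N" "t \<notin> \<Union>N"
    and Nmax: "\<And>N'. max_matching E X N' \<Longrightarrow> t \<notin> \<Union>N' \<Longrightarrow> card (M \<inter> N') \<le> card (M \<inter> N)"
    by blast
  have uN: "u \<in> \<Union>N" and vN: "v \<in> \<Union>N"
    using ut ut' tv tv' N by (auto simp: jointly_covered_def)
  have smM: "set_matching E X M" and smN: "set_matching E X N"
    using M N by (auto simp: max_matching_def)
  have finN: "finite N" using fin smN by (rule set_matching_finite)
  have "card M = card N" using M N by (auto simp: max_matching_def intro: antisym)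
  then have cards: "card (\<Union>M) = card (\<Union>N)"
    using set_matching_card(1)[OF fin E(2)] smM smN by simp
  have finU: "finite (\<Union>M)" "finite (\<Union>N)"
    using fin smM smN set_matching_Union_subset by (meson finite_subset)+
  \<comment> \<open>\<open>M\<close> and \<open>N\<close> cover equally many vertices and
    \<open>N\<close> covers \<open>u\<close> and \<open>v\<close>, which \<open>M\<close> avoids. So
    \<open>M\<close> covers two vertices that \<open>N\<close> avoids, and one of them differs from
    \<open>t\<close>.\<close>
  have "card (\<Union>M - \<Union>N) = card (\<Union>N - \<Union>M)"
    using cards finU card_Diff_subset_Int[of "\<Union>M" "\<Union>N"] card_Diff_subset_Int[of "\<Union>N" "\<Union>M"]
    by (simp add: Int_commute)
  also have "\<dots> \<ge> card {u, v}"
    using finU uN vN M by (intro card_mono) auto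
  finally have "2 \<le> card (\<Union>M - \<Union>N)" using uv by simp
  then have "\<not> \<Union>M - \<Union>N \<subseteq> {t}" using card_mono[of "{t}" "\<Union>M - \<Union>N"] by auto
  then obtain x where x: "x \<in> \<Union>M" "x \<notin> \<Union>N" "x \<noteq> t" by auto
  then obtain e where e: "e \<in> M" "x \<in> e" by auto
  then obtain y where y: "e = {x, y}" "(x, y) \<in> E" "x \<in> X" "y \<in> X"
    using smM E(1) unfolding set_matching_def sym_def by blast
  have yx: "y \<noteq> x" using y E(2) by (auto simp: irrefl_def)
  have "y \<in> \<Union>N" using max_matching_no_edge[OF fin N(1) y(2-4) x(2)] by auto
  then obtain g where g: "g \<in> N" "y \<in> g" by auto
  have yt: "y \<noteq> t" using g N by auto
  have "set_matching E X (N - {g})" using smN by (rule set_matching_subset) auto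
  moreover have "y \<notin> \<Union>(N - {g})"
    using set_matching_unique[OF smN g(1) _ g(2)] by blast
  ultimately have sm: "set_matching E X (insert {x, y} (N - {g}))"
    using y x by (intro set_matching_insert) auto
  have nin: "{x, y} \<notin> N - {g}" using x by auto
  have cardN': "card (insert {x, y} (N - {g})) = card N"
    using card_insert_disjoint[of "N - {g}" "{x, y}"] card_Suc_Diff1[of N g] nin finN g by simp
  have "max_matching E X (insert {x, y} (N - {g}))"
    using sm cardN' N by (auto simp: max_matching_def)
  moreover have "t \<notin> \<Union>(insert {x, y} (N - {g}))" using N x yt by auto
  ultimately have "card (M \<inter> insert {x, y} (N - {g})) \<le> card (M \<inter> N)" by (rule Nmax)
  moreover have "g \<notin> M"
  proof
    assume "g \<in> M"
    moreover have "g \<noteq> e" using g e x by auto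
    ultimately show False using set_matching_unique[OF smM e(1), of g y] g y(1) by simp
  qed
  then have "M \<inter> insert {x, y} (N - {g}) = insert e (M \<inter> N)" using e y by auto
  moreover have "e \<notin> N" using e x by auto
  ultimately show False using finM by simp
qed

text \<open>A maximum matching cannot avoid both ends of an edge, for the edge could be added;
  transitivity carries this along a path.\<close>

lemma jointly_covered_reach:
  assumes fin: "finite X" and E: "sym E" "irrefl E"
    and avoid: "\<And>t. t \<in> X \<Longrightarrow> \<exists>N. max_matching E X N \<and> t \<notin> \<Union>N"
    and uv: "u \<in> X" "(u, v) \<in> (Restr E X)\<^sup>*"
  shows "v \<in> X \<and> jointly_covered E X u v"
  using uv(2)
proof (induction rule: rtrancl_induct)
  case base
  then show ?case using uv by (simp add: jointly_covered_def)
next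
  case (step y z)
  have "jointly_covered E X y z"
  proof (unfold jointly_covered_def, rule disjI2, rule notI)
    assume "\<exists>M. max_matching E X M \<and> y \<notin> \<Union>M \<and> z \<notin> \<Union>M"
    then obtain M where "max_matching E X M" "y \<notin> \<Union>M" "z \<notin> \<Union>M" by blast
    then show False using max_matching_no_edge[OF fin, of E M y z] step(2) by simp
  qed
  then show ?case using step jointly_covered_trans[OF fin E uv(1) _ _ avoid] by blast
qed

text \<open>A vertex covered by every maximum matching is deleted and put into \<open>U\<close>. If
  there is no such vertex, \<open>U = {}\<close> works: by Gallai's lemma each class contains at
  most one vertex that \<open>M\<close> leaves uncovered, and a class with such a vertex is
  odd.\<close>

theorem Tutte_Berge:
  assumes "finite X" "sym E" "irrefl E"
  shows "\<exists>M U. set_matching E X M \<and> U \<subseteq> X \<and>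
           card X + card U \<le> 2 * card M + card (odd_classes E (X - U))"
  using assms
proof (induction "card X" arbitrary: X rule: less_induct)
  case less
  note fin = less.prems(1)
  show ?case
  proof (cases "\<exists>v\<in>X. \<forall>M. max_matching E X M \<longrightarrow> v \<in> \<Union>M")
    case True
    then obtain v where v: "v \<in> X" "\<And>M. max_matching E X M \<Longrightarrow> v \<in> \<Union>M" by blast
    obtain M where M: "max_matching E X M" using max_matching_exists[OF fin] by blast
    have cX: "card (X - {v}) = card X - 1" "card X > 0"
      using v fin by (auto simp: card_gt_0_iff)
    then obtain M' U' where M': "set_matching E (X - {v}) M'" and U': "U' \<subseteq> X - {v}"
      and le: "card (X - {v}) + card U' \<le> 2 * card M' + card (odd_classes E (X - {v} - U'))"
      using less.hyps[of "X - {v}"] less.prems by auto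
    have smM': "set_matching E X M'" using M' by (rule set_matching_mono) auto
    \<comment> \<open>Deleting \<open>v\<close> lowers the matching number. The extra edge of
      \<open>M\<close> counts twice and pays for \<open>v\<close> being counted both in
      \<open>X\<close> and in \<open>U\<close>.\<close>
    have "v \<notin> \<Union>M'" using set_matching_Union_subset[OF M'] by blast
    then have "\<not> max_matching E X M'" using v(2) by blast
    then obtain N where "set_matching E X N" "card M' < card N"
      using smM' by (auto simp: max_matching_def not_le)
    then have "card M' < card M"
      using M unfolding max_matching_def by (blast intro: less_le_trans)
    moreover have "card (insert v U') = Suc (card U')"
      using U' fin by (intro card_insert_disjoint) (auto intro: finite_subset)
    moreover have "X - {v} - U' = X - insert v U'" by auto
    ultimately have "card X + card (insert v U') \<le> 2 * card M + card (odd_classes E (X - insert v U'))"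
      using le cX by simp
    then show ?thesis using M U' v(1) by (intro exI[of _ M] exI[of _ "insert v U'"]) (auto simp: max_matching_def)
  next
    case False
    then have avoid: "\<exists>N. max_matching E X N \<and> t \<notin> \<Union>N" if "t \<in> X" for t using that by metis
    obtain M where M: "max_matching E X M" using max_matching_exists[OF fin] by blast
    then have smM: "set_matching E X M" by (simp add: max_matching_def)
    have finM: "finite M" using set_matching_finite[OF fin smM] .
    have alone: "w = u" if "u \<in> X - \<Union>M" "w \<in> reach_class E X u" "w \<notin> \<Union>M" for u w
    proof -
      have "jointly_covered E X u w"
        using jointly_covered_reach[OF fin less.prems(2,3) avoid, of u w] that
        unfolding reach_class_def by simp
      then show ?thesis using that M unfolding jointly_covered_def by blast
    qed
    have odd: "odd (card (reach_class E X u))" if u: "u \<in> X - \<Union>M" for u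
    proof -
      let ?C = "reach_class E X u" and ?N = "{e \<in> M. e \<subseteq> reach_class E X u}"
      have uC: "u \<in> ?C" using u by (simp add: reach_class_refl)
      \<comment> \<open>Edges of \<open>M\<close> never leave a class, so all of the class except
        \<open>u\<close> is a disjoint union of edges.\<close>
      have "?C - {u} \<subseteq> \<Union>?N"
      proof
        fix w assume w: "w \<in> ?C - {u}"
        then have "w \<in> \<Union>M" using alone[OF u, of w] by auto
        then obtain e where e: "e \<in> M" "w \<in> e" by blast
        then obtain a b where ab: "e = {a, b}" "(a, b) \<in> E" "a \<in> X" "b \<in> X"
          using smM unfolding set_matching_def by blast
        have "reach_class E X w = ?C" using w u less.prems(2) by (intro reach_class_eq) auto
        moreover have "reach_class E X a = reach_class E X b"
          using reach_class_edge[OF ab(2-4) less.prems(2)] .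
        moreover have "w = a \<or> w = b" using e(2) ab(1) by simp
        ultimately have "reach_class E X a = ?C" "reach_class E X b = ?C" by auto
        then have "e \<subseteq> ?C"
          using ab(1) reach_class_refl[OF ab(3), of E] reach_class_refl[OF ab(4), of E] by simp
        then show "w \<in> \<Union>?N" using e by auto
      qed
      moreover have "\<Union>?N \<subseteq> ?C" by auto
      moreover have "u \<notin> \<Union>?N" using u by auto
      ultimately have "?C - {u} = \<Union>?N" by (intro equalityI) auto
      moreover have "card (\<Union>?N) = 2 * card ?N"
      proof (rule card_Union_pairs)
        have "set_matching E X ?N" using smM by (rule set_matching_subset) auto
        then show "pairwise disjnt ?N" by (simp add: set_matching_def)
      qed (use finM set_matching_card_edge[OF less.prems(3) smM] in auto)
      ultimately have "card (?C - {u}) = 2 * card ?N" by simp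
      moreover have "finite ?C" using fin by (simp add: reach_class_def)
      ultimately have "card ?C = Suc (2 * card ?N)" using uC card_Suc_Diff1[of ?C u] by simp
      then show ?thesis by simp
    qed
    have inj: "inj_on (reach_class E X) (X - \<Union>M)"
    proof (rule inj_onI)
      fix u w assume "u \<in> X - \<Union>M" "w \<in> X - \<Union>M" "reach_class E X u = reach_class E X w"
      then show "u = w" using alone[of w u] reach_class_refl[of u X E] by auto
    qed
    have "card (X - \<Union>M) = card (reach_class E X ` (X - \<Union>M))" using inj by (simp add: card_image)
    also have "\<dots> \<le> card (odd_classes E X)"
      using odd fin by (intro card_mono) (auto simp: odd_classes_def)
    finally have "card X + card {} \<le> 2 * card M + card (odd_classes E (X - {}))"
      using set_matching_card(2)[OF fin less.prems(3) smM] by simp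
    then show ?thesis using smM by blast
  qed
qed

section \<open>Cuts in critical graphs\<close>

text \<open>The partner map \<open>g\<close> has no fixed point and is an involution:
  \<open>g c\<close> lies in \<open>N (g (g c))\<close>, so by symmetry \<open>g (g c)\<close> lies
  in \<open>N (g c)\<close>, whose only element in \<open>C\<close> is \<open>c\<close>.\<close>

lemma even_card_if_unique_partner:
  fixes N :: "'a \<Rightarrow> 'a set"
  assumes fin: "finite C"
    and sym: "\<And>x y. x \<in> C \<Longrightarrow> y \<in> C \<Longrightarrow> y \<in> N x \<Longrightarrow> x \<in> N y"
    and ex: "\<And>c. c \<in> C \<Longrightarrow> \<exists>y\<in>C. y \<noteq> c \<and> N y \<inter> C = {c}"
  shows "even (card C)"
proof -
  obtain g where g: "\<And>c. c \<in> C \<Longrightarrow> g c \<in> C \<and> g c \<noteq> c \<and> N (g c) \<inter> C = {c}"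
    using ex by metis
  have gg: "g (g c) = c" if "c \<in> C" for c
    using g[OF that] g[of "g c"] sym[of "g (g c)" "g c"] that by blast
  have card2: "card {c, g c} = 2" if "c \<in> C" for c
  proof -
    have "c \<noteq> g c" using g[OF that] by metis
    then show ?thesis by simp
  qed
  let ?M = "(\<lambda>c. {c, g c}) ` C"
  have "card (\<Union>?M) = 2 * card ?M"
  proof (rule card_Union_pairs)
    show "pairwise disjnt ?M"
    proof (rule pairwiseI)
      fix e e' assume "e \<in> ?M" "e' \<in> ?M" "e \<noteq> e'"
      then obtain c d where "c \<in> C" "d \<in> C" "e = {c, g c}" "e' = {d, g d}" by blast
      moreover from this have "e = e'" if "c = d \<or> c = g d \<or> g c = d \<or> g c = g d"
        using that gg[of c] gg[of d] by (metis insert_commute)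
      ultimately show "disjnt e e'"
        using \<open>e \<noteq> e'\<close> by (auto simp: disjnt_def)
    qed
  qed (use fin card2 in auto)
  moreover have "\<Union>?M = C" using g by auto
  ultimately show ?thesis by simp
qed

lemma card_subsets2_le:
  assumes "finite A" "finite B" "inj_on D A" "\<And>v. v \<in> A \<Longrightarrow> D v \<subseteq> B \<and> card (D v) = 2"
  shows "card A \<le> card B choose 2"
proof -
  have "card A = card (D ` A)" using assms(3) by (simp add: card_image)
  also have "\<dots> \<le> card {Q. Q \<subseteq> B \<and> card Q = 2}"
    using assms by (intro card_mono) auto
  also have "\<dots> = card B choose 2" using assms(2) by (rule n_subsets)
  finally show ?thesis .
qed

text \<open>
  \<open>N x\<close> is the set of non-neighbours of \<open>x\<close>, and \<open>f\<close> labels a vertex outside \<open>S\<close> by its component.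
\<close>

locale critical_cut =
  fixes V S :: "'a set" and N D :: "'a \<Rightarrow> 'a set" and f :: "'a \<Rightarrow> 'b"
  assumes finV: "finite V" and SV: "S \<subseteq> V"
    and N_sub: "x \<in> V \<Longrightarrow> N x \<subseteq> V - {x}"
    and N_sym: "x \<in> V \<Longrightarrow> y \<in> N x \<Longrightarrow> x \<in> N y"
    and D_sub: "v \<in> V \<Longrightarrow> D v \<subseteq> V"
    and D_card: "v \<in> V \<Longrightarrow> card (D v) = 2"
    and D_Int: "v \<in> V \<Longrightarrow> x \<in> D v \<Longrightarrow> y \<in> D v \<Longrightarrow> x \<noteq> y \<Longrightarrow> N x \<inter> N y = {v}"
    and sep: "x \<in> V - S \<Longrightarrow> y \<in> V - S \<Longrightarrow> f x \<noteq> f y \<Longrightarrow> y \<in> N x"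
begin

section \<open>Position of the pairs \<open>D v\<close> relative to the cut\<close>

abbreviation I :: "'a set" where "I \<equiv> V - S"

definition Nout :: "'a \<Rightarrow> 'a set" where "Nout x = N x \<inter> I"

lemma finS: "finite S" and finI: "finite I"
  using finV SV by (auto intro: finite_subset)

lemma finNout: "finite (Nout x)"
  using finI by (simp add: Nout_def)

lemma Nout_sub: "Nout x \<subseteq> I"
  by (simp add: Nout_def)

lemma card_V: "card V = card S + card I"
  using finV SV by (simp add: card_Diff_subset finS card_mono)

lemma D_pair:
  assumes "v \<in> V" "x \<in> D v"
  obtains y where "D v = {x, y}" "x \<noteq> y" "x \<in> V" "y \<in> V" "N x \<inter> N y = {v}"
    "v \<in> N x" "v \<in> N y" "x \<in> N v" "y \<in> N v"
proof -
  obtain a b where ab: "D v = {a, b}" "a \<noteq> b"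
    using D_card[OF assms(1)] by (auto simp: card_2_iff)
  define y where "y = (if x = a then b else a)"
  have y: "D v = {x, y}" "x \<noteq> y" using ab assms(2) by (auto simp: y_def)
  have "N x \<inter> N y = {v}" using D_Int[OF assms(1)] y by simp
  moreover have "x \<in> V" "y \<in> V" using D_sub[OF assms(1)] y by auto
  ultimately show ?thesis using y N_sym by (intro that[of y]) auto
qed

lemma D_nonempty: "v \<in> V \<Longrightarrow> \<exists>x. x \<in> D v"
  using D_card by (metis card.empty equals0I zero_neq_numeral)

lemma D_sub_N: "v \<in> V \<Longrightarrow> D v \<subseteq> N v"
  using D_pair by blast

lemma D_irrefl: "v \<in> V \<Longrightarrow> v \<notin> D v"
  using D_sub_N N_sub by blast

text \<open>If \<open>D w\<close> lies in \<open>N v\<close>, then \<open>v\<close> is a common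
  non-neighbour of the pair \<open>D w\<close>, and \<open>w\<close> is the only one. Besides
  injectivity of \<open>D\<close>, this says that \<open>N v\<close> contains no pair
  \<open>D w\<close> other than its own.\<close>

lemma D_private:
  assumes "v \<in> V" "w \<in> V" "D w \<subseteq> N v"
  shows "v = w"
proof -
  obtain x where "x \<in> D w" using D_nonempty assms(2) by blast
  then obtain y where "D w = {x, y}" "N x \<inter> N y = {w}" using D_pair assms(2) by metis
  then show ?thesis using assms N_sym by blast
qed

lemma D_inj: "inj_on D V"
  using D_private D_sub_N by (metis inj_onI)

lemma card_D_subset_le:
  assumes "A \<subseteq> V" "finite B"
  shows "card {v \<in> A. D v \<subseteq> B} \<le> card B choose 2"
  using assms finV D_inj D_card
  by (intro card_subsets2_le[of _ _ D]) (auto intro: finite_subset inj_on_subset)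

lemma D_outside:
  assumes "v \<in> V" "D v = {x, y}" "x \<noteq> y" "x \<in> I" "y \<in> I" "u \<in> I" "f u \<noteq> f x" "f u \<noteq> f y"
  shows "u = v"
proof -
  have "u \<in> N x \<inter> N y" using sep[of x u] sep[of y u] assms by auto
  then show ?thesis using D_Int[of v x y] assms by auto
qed

text \<open>A vertex outside the components of a pair is a non-neighbour of both members. So if
  \<open>D v\<close> avoids \<open>S\<close>, only the components of its two members and of
  \<open>v\<close> can exist.\<close>

lemma D_meets_S:
  assumes "card (f ` I) \<ge> 4" "v \<in> V"
  shows "\<exists>x\<in>S. x \<in> D v"
proof (rule ccontr)
  assume *: "\<not> ?thesis"
  obtain x where "x \<in> D v" using D_nonempty assms(2) by blast
  then obtain y where xy: "D v = {x, y}" "x \<noteq> y" "x \<in> V" "y \<in> V" using D_pair assms(2) by metis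
  have "f ` I \<subseteq> {f x, f y, f v}"
    using D_outside[OF assms(2) xy(1,2)] xy * by blast
  then have "card (f ` I) \<le> card {f x, f y, f v}" by (intro card_mono) auto
  also have "\<dots> \<le> 3" by (simp add: card_insert_if)
  finally show False using assms by simp
qed

text \<open>A vertex of \<open>Nout x\<close> in another component than \<open>y\<close> is a
  non-neighbour of \<open>y\<close> too, hence is the only common non-neighbour
  \<open>v\<close>.\<close>

lemma mixed_Nout:
  assumes "v \<in> V" "D v = {x, y}" "x \<in> S" "y \<in> I"
  shows "u \<in> Nout x \<Longrightarrow> u \<noteq> v \<Longrightarrow> f u = f y"
  using D_Int[of v x y] sep[of y u] assms unfolding Nout_def by fastforce

lemma mixed_Nout_outer:
  assumes "v \<in> I" "D v = {x, y}" "x \<in> S" "y \<in> I"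
  shows "card (f ` Nout x) \<le> 2"
proof -
  have "f ` Nout x \<subseteq> {f v, f y}" using mixed_Nout[of v x y] assms by auto
  then have "card (f ` Nout x) \<le> card {f v, f y}" by (intro card_mono) auto
  then show ?thesis by (simp add: card_insert_if split: if_splits)
qed

text \<open>Here the exceptional vertex \<open>a\<close> is itself in \<open>S\<close>, so it
  contributes no label; this is one label fewer than in \<open>mixed_Nout_outer\<close>.\<close>

lemma mixed_Nout_inner:
  assumes "a \<in> S" "D a = {x, y}" "x \<in> S" "y \<in> I"
  shows "f ` Nout x \<subseteq> {f y}" "card (f ` Nout x) \<le> 1"
proof -
  show *: "f ` Nout x \<subseteq> {f y}" using mixed_Nout[of a x y] assms SV unfolding Nout_def by auto
  then have "card (f ` Nout x) \<le> card {f y}" by (intro card_mono) auto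
  then show "card (f ` Nout x) \<le> 1" by simp
qed

section \<open>Covering the components by non-neighbourhoods and pairs\<close>

definition servers :: "'a set \<Rightarrow> 'a set \<Rightarrow> 'a set" where
  "servers A B = {x \<in> B. \<exists>v\<in>A. \<exists>y\<in>I. D v = {x, y}}"

text \<open>Each \<open>v\<close> in \<open>A\<close> is a non-neighbour of both members of
  \<open>D v\<close>. Either one of them is a server, and \<open>v\<close> is counted in its
  \<open>Nout\<close>, or \<open>D v\<close> is a pair inside \<open>B\<close> without servers; as
  \<open>D\<close> is injective, such pairs are counted by the binomial coefficient.\<close>

lemma cover:
  assumes A: "A \<subseteq> I" and B: "B \<subseteq> S" and AB: "\<And>x v. x \<in> S - B \<Longrightarrow> v \<in> A \<Longrightarrow> v \<notin> N x"
    and m: "card (f ` I) \<ge> 4"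
  shows "card (f ` A) \<le> (\<Sum>x\<in>servers A B. card (f ` (Nout x \<inter> A)))
           + (card B - card (servers A B) choose 2)"
proof -
  let ?K = "servers A B"
  have KB: "?K \<subseteq> B" by (auto simp: servers_def)
  have finB: "finite B" using B finS finite_subset by blast
  have finK: "finite ?K" using KB finB finite_subset by blast
  have finA: "finite A" using finI A finite_subset by blast
  have "A \<subseteq> (\<Union>x\<in>?K. Nout x \<inter> A) \<union> {v \<in> A. D v \<subseteq> B - ?K}"
  proof
    fix v assume v: "v \<in> A"
    then have vV: "v \<in> V" using A by auto
    obtain x where x: "x \<in> S" "x \<in> D v" using D_meets_S[OF m vV] by blast
    then obtain y where y: "D v = {x, y}" "y \<in> V" "v \<in> N x" "v \<in> N y" using D_pair[OF vV] by metis
    have vW: "v \<in> Nout x" "v \<in> Nout y" using y v A by (auto simp: Nout_def)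
    have xB: "x \<in> B" using AB x v y by blast
    show "v \<in> (\<Union>x\<in>?K. Nout x \<inter> A) \<union> {v \<in> A. D v \<subseteq> B - ?K}"
    proof (cases "y \<in> S")
      case True
      then have "y \<in> B" using AB v y by blast
      then show ?thesis using y vW v xB by auto
    next
      case False
      then have "x \<in> ?K" using xB v y by (auto simp: servers_def)
      then show ?thesis using vW v by auto
    qed
  qed
  then have "f ` A \<subseteq> (\<Union>x\<in>?K. f ` (Nout x \<inter> A)) \<union> f ` {v \<in> A. D v \<subseteq> B - ?K}" by blast
  then have "card (f ` A) \<le> card ((\<Union>x\<in>?K. f ` (Nout x \<inter> A)) \<union> f ` {v \<in> A. D v \<subseteq> B - ?K})"
    using finK finNout finA by (intro card_mono) auto
  also have "\<dots> \<le> card (\<Union>x\<in>?K. f ` (Nout x \<inter> A)) + card (f ` {v \<in> A. D v \<subseteq> B - ?K})"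
    by (rule card_Un_le)
  also have "card (\<Union>x\<in>?K. f ` (Nout x \<inter> A)) \<le> (\<Sum>x\<in>?K. card (f ` (Nout x \<inter> A)))"
    using finK by (rule card_UN_le)
  also have "card (f ` {v \<in> A. D v \<subseteq> B - ?K}) \<le> card {v \<in> A. D v \<subseteq> B - ?K}"
    using finA by (intro card_image_le) auto
  also have "\<dots> \<le> card (B - ?K) choose 2"
    using A finB by (intro card_D_subset_le) auto
  also have "card (B - ?K) = card B - card ?K" using KB finK by (simp add: card_Diff_subset)
  finally show ?thesis by simp
qed

lemma servers_Nout:
  assumes "A \<subseteq> I" "B \<subseteq> S" "x \<in> servers A B"
  shows "card (f ` Nout x) \<le> 2"
  using assms mixed_Nout_outer unfolding servers_def by blast

lemma cover_le:
  assumes "A \<subseteq> I" "B \<subseteq> S" "\<And>x v. x \<in> S - B \<Longrightarrow> v \<in> A \<Longrightarrow> v \<notin> N x" "card (f ` I) \<ge> 4"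
  shows "card (f ` A) \<le> 2 * card (servers A B) + (card B - card (servers A B) choose 2)"
proof -
  have "(\<Sum>x\<in>servers A B. card (f ` (Nout x \<inter> A))) \<le> (\<Sum>x\<in>servers A B. 2)"
  proof (rule sum_mono)
    fix x assume "x \<in> servers A B"
    then have "card (f ` Nout x) \<le> 2" using servers_Nout assms by blast
    moreover have "card (f ` (Nout x \<inter> A)) \<le> card (f ` Nout x)" using finNout by (intro card_mono) auto
    ultimately show "card (f ` (Nout x \<inter> A)) \<le> 2" by simp
  qed
  then show ?thesis using cover[OF assms] by simp
qed

text \<open>With \<open>k\<close> servers the bound \<open>2 * k + (3 - k choose 2)\<close> is 3, 3,
  4, 6 for \<open>k = 0, 1, 2, 3\<close>; five labels therefore force all of \<open>B\<close> to be
  servers, and no pair is left.\<close>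

lemma cover_three:
  assumes "A \<subseteq> I" "B \<subseteq> S" "\<And>x v. x \<in> S - B \<Longrightarrow> v \<in> A \<Longrightarrow> v \<notin> N x" "card (f ` A) \<ge> 5" "card B = 3"
  shows "card (f ` A) \<le> (\<Sum>x\<in>B. card (f ` (Nout x \<inter> A)))" "\<And>x. x \<in> B \<Longrightarrow> card (f ` Nout x) \<le> 2"
proof -
  have "card (f ` A) \<le> card (f ` I)" using assms(1) finI by (intro card_mono) auto
  then have m: "card (f ` I) \<ge> 4" using assms by simp
  have finB: "finite B" using assms(2) finS finite_subset by blast
  have K: "servers A B \<subseteq> B" by (auto simp: servers_def)
  let ?k = "card (servers A B)"
  have le: "?k \<le> 3" using K finB assms(5) card_mono by metis
  moreover have "5 \<le> 2 * ?k + (3 - ?k choose 2)" using cover_le[OF assms(1-3) m] assms by simp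
  ultimately have "?k = 3" by (cases "?k = 0 \<or> ?k = 1 \<or> ?k = 2") (auto simp: numeral_eq_Suc)
  then have K: "servers A B = B" using K finB assms(5) card_subset_eq by metis
  show "card (f ` A) \<le> (\<Sum>x\<in>B. card (f ` (Nout x \<inter> A)))" using cover[OF assms(1-3) m] K by (simp add: binomial_eq_0)
  show "\<And>x. x \<in> B \<Longrightarrow> card (f ` Nout x) \<le> 2" using servers_Nout[OF assms(1,2)] K by simp
qed

section \<open>Cuts with at most four vertices\<close>

lemma cut_empty:
  assumes S: "S = {}" and ev: "even (card V)" and m: "card (f ` I) \<ge> 2"
    and odd: "\<And>k. card (f ` I) = 2 \<Longrightarrow> k \<in> f ` I \<Longrightarrow> odd (card {u \<in> I. f u = k})"
  shows False
proof -
  let ?C = "\<lambda>k. {u \<in> V. f u = k}"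
  have m4: "card (f ` V) < 4"
  proof (rule ccontr)
    assume "\<not> ?thesis"
    moreover have "V \<noteq> {}" using m by auto
    ultimately show False using D_meets_S S by auto
  qed
  have img: "f ` V \<subseteq> {f x, f y, f v} \<and> ?C (f v) = {v}"
    if v: "v \<in> V" "D v = {x, y}" "x \<noteq> y" "f v \<noteq> f x" "f v \<noteq> f y" for v x y
  proof -
    have "x \<in> I" "y \<in> I" using D_sub[OF v(1)] v(2) S by auto
    then have *: "u = v" if "u \<in> V" "f u \<noteq> f x" "f u \<noteq> f y" for u
      using D_outside[OF v(1-3)] that S by simp
    have "f ` V \<subseteq> {f x, f y, f v}"
    proof
      fix k assume "k \<in> f ` V"
      then obtain u where "u \<in> V" "k = f u" by blast
      then show "k \<in> {f x, f y, f v}" using *[of u] by auto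
    qed
    moreover have "?C (f v) \<subseteq> {v}"
    proof
      fix u assume "u \<in> ?C (f v)"
      then have "u \<in> V" "f u = f v" by auto
      then show "u \<in> {v}" using * v(4,5) by (metis singletonI)
    qed
    ultimately show ?thesis using v(1) by blast
  qed
  show False
  proof (cases "card (f ` V) = 3")
    case True
    \<comment> \<open>A pair meets at most two of the three components, and any vertex in a
      component it does not meet must be \<open>v\<close>. So every vertex is a component of its
      own.\<close>
    have single: "?C (f v) = {v}" if v: "v \<in> V" for v
    proof -
      obtain x where "x \<in> D v" using D_nonempty v by blast
      then obtain y where xy: "D v = {x, y}" "x \<noteq> y" "x \<in> V" "y \<in> V" using D_pair v by metis
      have "\<not> f ` V \<subseteq> {f x, f y}"
      proof
        assume "f ` V \<subseteq> {f x, f y}"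
        then have "card (f ` V) \<le> card {f x, f y}" by (intro card_mono) auto
        then show False using True by (simp add: card_insert_if split: if_splits)
      qed
      then obtain u where u: "u \<in> V" "f u \<noteq> f x" "f u \<noteq> f y" by auto
      then have "u = v" using D_outside[OF v xy(1,2)] xy S by simp
      then show ?thesis using img[OF v xy(1,2)] u by auto
    qed
    have "inj_on f V"
    proof (rule inj_onI)
      fix u w assume "u \<in> V" "w \<in> V" "f u = f w"
      then have "u \<in> ?C (f w)" "?C (f w) = {w}" using single by auto
      then show "u = w" by auto
    qed
    then have "card V = 3" using True card_image by metis
    then show False using ev by simp
  next
    case False
    then have m2: "card (f ` V) = 2" using m m4 S by simp
    obtain k l where kl: "f ` V = {k, l}" "k \<noteq> l" using m2 by (auto simp: card_2_iff)
    have one: "card (?C (f v)) = 1" if v: "v \<in> V" for v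
    proof (rule ccontr)
      assume n1: "card (?C (f v)) \<noteq> 1"
      \<comment> \<open>In a class with more than one vertex, \<open>D c\<close> has exactly one
        member in the class of \<open>c\<close>. The other member has no neighbours there, so the
        first one has \<open>c\<close> as its only non-neighbour in the class.\<close>
      have "even (card (?C (f v)))"
      proof (rule even_card_if_unique_partner[where N = N])
        fix c assume c: "c \<in> ?C (f v)"
        then have cV: "c \<in> V" and fc: "f c = f v" by auto
        obtain x where "x \<in> D c" using D_nonempty cV by blast
        then obtain y where xy: "D c = {x, y}" "x \<noteq> y" "x \<in> V" "y \<in> V" "N x \<inter> N y = {c}"
          using D_pair cV by metis
        have nc: "x \<noteq> c" "y \<noteq> c" using D_irrefl[OF cV] xy by auto
        have nsing: "?C (f v) \<noteq> {c}" using n1 by auto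
        have fcx: "\<not> (f c \<noteq> f x \<and> f c \<noteq> f y)" using img[OF cV xy(1,2)] nsing fc by auto
        have nxy: "f x \<noteq> f y"
        proof
          assume fxy: "f x = f y"
          then have "f c = f x" using fcx by auto
          moreover obtain u where "u \<in> V" "f u \<noteq> f x"
            using kl by (metis imageE insertI1 insertI2)
          ultimately show False using D_outside[OF cV xy(1,2), of u] xy S fxy by auto
        qed
        have *: "\<exists>y'\<in>?C (f v). y' \<noteq> c \<and> N y' \<inter> ?C (f v) = {c}"
          if "{y', z} = {x, y}" "f c = f y'" "f z \<noteq> f y'" for y' z
        proof -
          have yz: "y' \<in> V" "z \<in> V" "y' \<noteq> c" "N y' \<inter> N z = {c}"
            using that(1) xy nc by (auto simp: doubleton_eq_iff)
          have "?C (f v) \<subseteq> N z" using sep[of z] yz S that fc by auto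
          then show ?thesis using yz that fc c by auto
        qed
        show "\<exists>y\<in>?C (f v). y \<noteq> c \<and> N y \<inter> ?C (f v) = {c}"
          using fcx nxy *[of x y] *[of y x] by (auto simp: insert_commute)
      qed (use finV N_sym in auto)
      then show False using odd[of "f v"] m2 v S by auto
    qed
    have "k \<in> f ` V" "l \<in> f ` V" using kl by auto
    then have "card (?C k) = 1" "card (?C l) = 1" using one by auto
    moreover have "V = ?C k \<union> ?C l" using kl by auto
    moreover have "card (?C k \<union> ?C l) \<le> card (?C k) + card (?C l)" by (rule card_Un_le)
    ultimately have "card V \<le> 2" by simp
    \<comment> \<open>Any \<open>v\<close> together with \<open>D v\<close> gives three
      vertices.\<close>
    moreover obtain v where v: "v \<in> V" using kl by auto
    have "insert v (D v) \<subseteq> V" using v D_sub by auto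
    then have "card (insert v (D v)) \<le> card V" using finV by (rule card_mono[rotated])
    moreover have "card (insert v (D v)) = 3"
      using D_irrefl[OF v] D_card[OF v] card_insert_disjoint[of "D v" v] by (simp add: card_ge_0_finite)
    ultimately show False by simp
  qed
qed

text \<open>The pair of the only vertex of \<open>S\<close> lies outside \<open>S\<close>, and a
  vertex in a third component would be a second common non-neighbour.\<close>

lemma cut_size_one:
  assumes "card S = 1" "card (f ` I) \<ge> 3"
  shows False
proof -
  obtain s where s: "S = {s}" using assms(1) card_1_singletonE by blast
  then have sV: "s \<in> V" using SV by auto
  obtain x where "x \<in> D s" using D_nonempty sV by blast
  then obtain y where xy: "D s = {x, y}" "x \<noteq> y" "x \<in> V" "y \<in> V" using D_pair sV by metis
  have I: "x \<in> I" "y \<in> I" using D_irrefl[OF sV] xy s by auto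
  have "f ` I \<subseteq> {f x, f y}" using D_outside[OF sV xy(1,2) I] s by blast
  then have "card (f ` I) \<le> card {f x, f y}" by (intro card_mono) auto
  also have "\<dots> \<le> 2" by (simp add: card_insert_if)
  finally show False using assms by simp
qed

text \<open>The bound \<open>2 * k + (2 - k choose 2)\<close> for \<open>k\<close> servers reaches 4
  only for \<open>k = 2\<close>, and then both vertices of \<open>S\<close> need two labels each.
  But \<open>D a\<close> consists of \<open>b\<close> and an outer vertex, which leaves
  \<open>b\<close> only one label.\<close>

lemma cut_size_two:
  assumes "card S = 2" "card (f ` I) \<ge> 4"
  shows False
proof -
  let ?K = "servers I S"
  have K: "?K \<subseteq> S" by (auto simp: servers_def)
  have "card ?K \<le> 2" using K finS assms(1) card_mono by metis
  moreover have "4 \<le> 2 * card ?K + (2 - card ?K choose 2)" using cover_le[of I S] assms by simp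
  ultimately have "card ?K = 2" by (cases "card ?K = 0 \<or> card ?K = 1") (auto simp: numeral_eq_Suc)
  then have KS: "?K = S" using K finS assms(1) card_subset_eq by metis
  have le: "4 \<le> (\<Sum>x\<in>S. card (f ` Nout x))"
    using cover[of I S] assms KS Nout_sub by (simp add: Int_absorb2 binomial_eq_0)
  have q: "\<And>x. x \<in> S \<Longrightarrow> card (f ` Nout x) \<le> 2" using servers_Nout[of I S] KS by simp
  obtain a b where S: "S = {a, b}" "a \<noteq> b" using assms(1) by (auto simp: card_2_iff)
  have aV: "a \<in> V" using S SV by auto
  have "b \<in> D a" using D_meets_S[OF assms(2) aV] D_irrefl[OF aV] S by auto
  then obtain y where y: "D a = {b, y}" "b \<noteq> y" "y \<in> V" using D_pair[OF aV] by metis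
  have "y \<in> I" using y D_irrefl[OF aV] S by auto
  then have "card (f ` Nout b) \<le> 1" using mixed_Nout_inner[of a b y] y S by auto
  then show False using le q[of a] S by simp
qed

text \<open>Every \<open>c\<close> in \<open>Nout x\<close> has \<open>D c = {x, y}\<close> with
  \<open>y\<close> outside \<open>S\<close>, so \<open>Nout x\<close> without \<open>c\<close> has a
  single label. With two labels present this leaves no room for a third vertex.\<close>

lemma disjoint_Nout_pair:
  assumes m: "card (f ` I) \<ge> 4" and x: "x \<in> S" and q: "card (f ` Nout x) = 2"
    and disj: "\<And>z. z \<in> S \<Longrightarrow> z \<noteq> x \<Longrightarrow> Nout x \<inter> Nout z = {}"
  shows "card (Nout x) = 2"
proof -
  obtain k l where kl: "f ` Nout x = {k, l}" "k \<noteq> l" using q by (auto simp: card_2_iff)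
  then have "k \<in> f ` Nout x" "l \<in> f ` Nout x" by simp_all
  then obtain v w where v: "v \<in> Nout x" "f v = k" and w: "w \<in> Nout x" "f w = l" by blast
  have same: "f a = f b" if "c \<in> Nout x" "a \<in> Nout x" "b \<in> Nout x" "a \<noteq> c" "b \<noteq> c" for a b c
  proof -
    have cV: "c \<in> V" using that Nout_sub by blast
    obtain z where z: "z \<in> S" "z \<in> D c" using D_meets_S[OF m cV] by blast
    obtain y where y: "D c = {z, y}" "z \<noteq> y" "y \<in> V" "c \<in> N z" "c \<in> N y"
      using D_pair[OF cV z(2)] by metis
    have "c \<in> Nout z" "c \<in> Nout y" using y that Nout_sub by (auto simp: Nout_def)
    then have "z = x" "y \<notin> S" using disj that z y by blast+
    then show ?thesis using mixed_Nout[of c x y] y z that cV by auto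
  qed
  have "Nout x = {v, w}"
  proof (rule ccontr)
    assume "Nout x \<noteq> {v, w}"
    then obtain u where u: "u \<in> Nout x" "u \<noteq> v" "u \<noteq> w" using v w by blast
    then have "f u = k \<or> f u = l" using kl by blast
    then show False using same[of v u w] same[of w u v] u v w kl by auto
  qed
  moreover have "v \<noteq> w" using kl v w by auto
  ultimately show ?thesis by simp
qed

lemma D_in_S_disjoint:
  assumes "a \<in> S" "D a = {x, y}" "x \<noteq> y"
  shows "Nout x \<inter> Nout y = {}"
proof -
  have "N x \<inter> N y = {a}" using D_Int[of a x y] assms SV by auto
  then show ?thesis using assms(1) unfolding Nout_def by auto
qed

text \<open>Both members of \<open>D v\<close> have \<open>v\<close> as a non-neighbour, so
  \<open>x\<close> is the only vertex of \<open>S\<close> that can occur in it.\<close>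

lemma sole_server:
  assumes m: "card (f ` I) \<ge> 4" and v: "v \<in> Nout x" and x: "x \<in> S"
    and disj: "\<And>z. z \<in> S \<Longrightarrow> z \<noteq> x \<Longrightarrow> v \<notin> Nout z"
  obtains y where "D v = {x, y}" "y \<in> I" "y \<noteq> v" "N x \<inter> N y = {v}"
proof -
  have vV: "v \<in> V" "v \<in> I" using v Nout_sub by blast+
  obtain z where z: "z \<in> S" "z \<in> D v" using D_meets_S[OF m vV(1)] by blast
  obtain y where y: "D v = {z, y}" "z \<noteq> y" "y \<in> V" "v \<in> N z" "v \<in> N y" "N z \<inter> N y = {v}"
    using D_pair[OF vV(1) z(2)] by metis
  have "v \<in> Nout z" "v \<in> Nout y" using y vV by (auto simp: Nout_def)
  then have "z = x" "y \<notin> S" using disj z(1) y(2) by metis+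
  moreover have "y \<noteq> v" using D_irrefl[OF vV(1)] y by auto
  ultimately show ?thesis using that y by blast
qed

text \<open>The first alternative is the structure of graph \<open>A\<close>. The second is excluded
  later: by parity when \<open>p = 5\<close>, and by having at least six components when
  \<open>p = 6\<close>.\<close>

lemma cut_size_three:
  assumes s: "card S = 3" and m: "card (f ` I) \<ge> 5"
  shows "(card V = 9 \<and> (\<forall>a\<in>S. S - {a} \<subseteq> N a) \<and> (\<forall>x\<in>S. card (Nout x) = 2) \<and>
           (\<forall>x\<in>S. \<forall>y\<in>S. x \<noteq> y \<longrightarrow> Nout x \<inter> Nout y = {}) \<and> I = (\<Union>x\<in>S. Nout x))
       \<or> (odd (card V) \<and> card (f ` I) = 5)"
proof -
  have m4: "card (f ` I) \<ge> 4" using m by simp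
  have cov: "card (f ` I) \<le> (\<Sum>x\<in>S. card (f ` Nout x))" and q: "\<And>x. x \<in> S \<Longrightarrow> card (f ` Nout x) \<le> 2"
    using cover_three[of I S] m s Nout_sub by (simp_all add: Int_absorb2)
  have IW: "I = (\<Union>x\<in>S. Nout x)"
  proof
    show "I \<subseteq> (\<Union>x\<in>S. Nout x)"
    proof
      fix v assume v: "v \<in> I"
      then obtain x where x: "x \<in> S" "x \<in> D v" using D_meets_S[OF m4] by blast
      then have "v \<in> N x" using D_pair[of v x] v by blast
      then show "v \<in> (\<Union>x\<in>S. Nout x)" using x v by (auto simp: Nout_def)
    qed
  qed (use Nout_sub in blast)
  have cardIW: "card I = (\<Sum>x\<in>S. card (Nout x))"
    if "\<And>x y. x \<in> S \<Longrightarrow> y \<in> S \<Longrightarrow> x \<noteq> y \<Longrightarrow> Nout x \<inter> Nout y = {}"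
    using finS finNout that by (subst IW, intro card_UN_disjoint) auto
  show ?thesis
  proof (cases "\<forall>x\<in>S. card (f ` Nout x) = 2")
    case True
    \<comment> \<open>A member of \<open>D a\<close> in \<open>S\<close> with a partner outside
      would have only one label, by \<open>mixed_Nout_inner\<close>.\<close>
    have DS: "D a = S - {a}" if a: "a \<in> S" for a
    proof -
      have aV: "a \<in> V" using a SV by auto
      have "D a \<subseteq> S"
      proof (rule ccontr)
        assume "\<not> D a \<subseteq> S"
        then obtain y where y: "y \<in> D a" "y \<notin> S" by blast
        obtain x where x: "x \<in> S" "x \<in> D a" using D_meets_S[OF m4 aV] by blast
        obtain y' where y': "D a = {x, y'}" "y' \<in> V" using D_pair[OF aV x(2)] by metis
        then have "y' \<in> I" using y x by auto
        then show False using mixed_Nout_inner(2)[OF a y'(1) x(1)] True x by auto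
      qed
      then have "D a \<subseteq> S - {a}" using D_irrefl[OF aV] by auto
      moreover have "card (S - {a}) = card (D a)" using D_card[OF aV] s a finS by simp
      ultimately show ?thesis using finS card_subset_eq[of "S - {a}" "D a"] by auto
    qed
    have disj: "Nout x \<inter> Nout y = {}" if "x \<in> S" "y \<in> S" "x \<noteq> y" for x y
    proof -
      have "card (S - {x, y}) = 1" using that s finS by (simp add: card_Diff_subset)
      then obtain a where a: "S - {x, y} = {a}" using card_1_singletonE by blast
      then have "D a = {x, y}" "a \<in> S" using DS[of a] that by auto
      then show ?thesis using D_in_S_disjoint that by metis
    qed
    have two: "card (Nout x) = 2" if "x \<in> S" for x
      using disjoint_Nout_pair[OF m4 that] True disj that by blast
    have "card I = 6" using cardIW disj two s by simp
    then have "card V = 9" using card_V s by simp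
    moreover have "\<forall>a\<in>S. S - {a} \<subseteq> N a" using DS D_sub_N SV by blast
    ultimately show ?thesis using two disj IW by blast
  next
    case False
    then obtain c where c: "c \<in> S" "card (f ` Nout c) \<noteq> 2" by blast
    then have qc: "card (f ` Nout c) \<le> 1" using q[of c] by simp
    have "card (S - {c}) = 2" using s c finS by simp
    then obtain a b where "S - {c} = {a, b}" and ab: "a \<noteq> b" by (auto simp: card_2_iff)
    then have S: "S = {a, b, c}" and abc: "a \<noteq> c" "b \<noteq> c" using c by auto
    \<comment> \<open>The three vertices supply at most \<open>2 + 2 + 1\<close> labels and five are
      needed, so all bounds are attained and the label sets are disjoint.\<close>
    have sum: "card (f ` I) \<le> card (f ` Nout a) + card (f ` Nout b) + card (f ` Nout c)"
      using cov S ab abc by (simp add: add.assoc)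
    then have qa: "card (f ` Nout a) = 2" and qb: "card (f ` Nout b) = 2" and qc1: "card (f ` Nout c) = 1"
      and m5: "card (f ` I) = 5"
      using q[of a] q[of b] qc m S by auto
    have "f ` I = f ` Nout a \<union> f ` Nout b \<union> f ` Nout c" using IW S by (auto simp: image_UN)
    then have c5: "card (f ` Nout a \<union> f ` Nout b \<union> f ` Nout c) = 5" using m5 by simp
    have fin: "finite (f ` Nout x)" for x using finNout by simp
    have ab4: "card (f ` Nout a \<union> f ` Nout b) \<le> 4" using card_Un_le[of "f ` Nout a" "f ` Nout b"] qa qb by simp
    have "card (f ` Nout a \<union> f ` Nout b) = 4" and i1: "card ((f ` Nout a \<union> f ` Nout b) \<inter> f ` Nout c) = 0"
      using card_Un_Int[of "f ` Nout a \<union> f ` Nout b" "f ` Nout c"] fin c5 qc1 ab4 by auto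
    then have i2: "card (f ` Nout a \<inter> f ` Nout b) = 0"
      using card_Un_Int[of "f ` Nout a" "f ` Nout b"] fin qa qb by auto
    have disjf: "f ` Nout x \<inter> f ` Nout y = {}" if "x \<in> S" "y \<in> S" "x \<noteq> y" for x y
      using i1 i2 fin that S by auto
    have disj: "Nout x \<inter> Nout y = {}" if "x \<in> S" "y \<in> S" "x \<noteq> y" for x y
      using disjf[OF that] by blast
    have two: "card (Nout a) = 2" "card (Nout b) = 2"
      using disjoint_Nout_pair[OF m4 _ qa] disjoint_Nout_pair[OF m4 _ qb] disj S by auto
    have cV: "c \<in> V" using c SV by auto
    have "D c \<subseteq> S"
    proof (rule ccontr)
      assume "\<not> D c \<subseteq> S"
      then obtain y where y: "y \<in> D c" "y \<notin> S" by blast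
      obtain x where x: "x \<in> S" "x \<in> D c" using D_meets_S[OF m4 cV] by blast
      obtain y' where y': "D c = {x, y'}" "y' \<in> V" using D_pair[OF cV x(2)] by metis
      then have "y' \<in> I" using y x by auto
      then have "card (f ` Nout x) \<le> 1" using mixed_Nout_inner(2)[OF c(1) y'(1) x(1)] by simp
      moreover have "x \<noteq> c" using x D_irrefl[OF cV] by auto
      ultimately show False using x S qa qb by auto
    qed
    then have "D c \<subseteq> {a, b}" using D_irrefl[OF cV] S by auto
    then have "D c = {a, b}" using D_card[OF cV] ab card_subset_eq[of "{a, b}" "D c"] by simp
    then have Uc: "a \<in> N c" "b \<in> N c" using D_sub_N[OF cV] by auto
    \<comment> \<open>For \<open>w\<close> in \<open>Nout c\<close> the partner is the
      \<open>y\<close> with \<open>D w = {c, y}\<close>. Since \<open>a\<close> and \<open>b\<close>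
      are non-neighbours of \<open>c\<close> and differ from \<open>w\<close>, they are adjacent to
      \<open>y\<close>; hence \<open>y\<close> lies in \<open>Nout c\<close> as well.\<close>
    have "even (card (Nout c))"
    proof (rule even_card_if_unique_partner[where N = N])
      fix w assume w: "w \<in> Nout c"
      obtain y where y: "D w = {c, y}" "y \<in> I" "y \<noteq> w" "N c \<inter> N y = {w}"
        using sole_server[OF m4 w c(1)] disj c(1) w by (metis disjoint_iff)
      have "w \<notin> S" using w Nout_sub by auto
      then have "a \<notin> N y" "b \<notin> N y" using y Uc S by auto
      then have "y \<notin> N a" "y \<notin> N b" using N_sym[of a y] N_sym[of b y] S SV by blast+
      then have "y \<notin> Nout a" "y \<notin> Nout b" by (simp_all add: Nout_def)
      then have "y \<in> Nout c" using y IW S by auto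
      moreover have "N y \<inter> Nout c = {w}" using y w Nout_sub by (auto simp: Nout_def)
      ultimately show "\<exists>y\<in>Nout c. y \<noteq> w \<and> N y \<inter> Nout c = {w}" using y by blast
    qed (use finNout Nout_sub N_sym in blast)+
    moreover have "card I = card (Nout a) + card (Nout b) + card (Nout c)"
      using cardIW disj S ab abc by (simp add: add.assoc)
    ultimately have "odd (card V)" using card_V s two by simp
    then show ?thesis using m5 by simp
  qed
qed

text \<open>
  The sets \<open>N a \<inter> S\<close> contain no pair \<open>D b\<close> with \<open>b \<noteq> a\<close>, which is impossible on four vertices.
\<close>

lemma cut_size_four_not_all_inner:
  assumes "card S = 4" and DS: "\<And>a. a \<in> S \<Longrightarrow> D a \<subseteq> S"
  shows False
proof -
  obtain a where a: "a \<in> S" using assms by fastforce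
  have V: "\<And>x. x \<in> S \<Longrightarrow> x \<in> V" using SV by blast
  obtain b where "b \<in> D a" using D_nonempty V a by blast
  then obtain c where bc: "D a = {b, c}" "b \<noteq> c" "N b \<inter> N c = {a}" using D_pair V a by metis
  have bcS: "b \<in> S" "c \<in> S" "b \<noteq> a" "c \<noteq> a" using DS[OF a] bc D_irrefl[OF V[OF a]] by auto
  have "card (S - {a, b, c}) = 1" using assms(1) a bc bcS finS by (simp add: card_Diff_subset)
  then obtain d where "S - {a, b, c} = {d}" using card_1_singletonE by blast
  then have S: "S = {a, b, c, d}" and d: "d \<noteq> a" "d \<noteq> b" "d \<noteq> c" using a bcS by auto
  \<comment> \<open>The pairs \<open>D a\<close> and \<open>D d\<close> share \<open>b'\<close>.
    Uniqueness of the common non-neighbour then makes \<open>c'\<close> adjacent to both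
    \<open>b'\<close> and \<open>d\<close>, leaving only \<open>a\<close> in \<open>S\<close> for
    the two members of \<open>D c'\<close>.\<close>
  have key: False
    if b': "D a = {b', c'}" and c': "D d = {a, b'}" and eq: "{b', c'} = {b, c}" for b' c'
  proof -
    have V': "a \<in> V" "b' \<in> V" "c' \<in> V" "d \<in> V" using V S eq by (auto simp: doubleton_eq_iff)
    have ne: "c' \<noteq> a" "c' \<noteq> b'" "c' \<noteq> d" "b' \<noteq> a" using eq bc bcS d by (auto simp: doubleton_eq_iff)
    have c'S: "c' \<in> S" using eq S by (auto simp: doubleton_eq_iff)
    have i1: "N b' \<inter> N c' = {a}" using D_Int[of a b' c'] b' ne V' by auto
    have i2: "N a \<inter> N b' = {d}" using D_Int[of d a b'] c' ne V' by auto
    have "c' \<in> N a" using D_sub_N[OF V'(1)] b' by auto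
    then have n1: "c' \<notin> N b'" using i2 ne by auto
    have "b' \<in> N d" using D_sub_N[OF V'(4)] c' by auto
    then have "d \<in> N b'" using N_sym V' by auto
    then have n2: "d \<notin> N c'" using i1 d by auto
    have "b' \<notin> N c'" using n1 N_sym[OF V'(3)] by auto
    then have "N c' \<inter> S \<subseteq> {a}" using n2 N_sub[OF V'(3)] S eq by (auto simp: doubleton_eq_iff)
    then have "D c' \<subseteq> {a}" using DS[OF c'S] D_sub_N[OF V'(3)] by auto
    then show False using D_card[OF V'(3)] card_mono[of "{a}" "D c'"] by simp
  qed
  have dV: "d \<in> V" using V S by auto
  have Dd: "D d \<subseteq> {a, b, c}" using DS[of d] D_irrefl[OF dV] S by auto
  have "D d \<noteq> {b, c}" using D_inj bc(1) d(1) dV V[OF a] by (metis inj_onD)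
  have "\<exists>x\<in>{b, c}. D d = {a, x}"
  proof -
    have "\<not> D d \<subseteq> {b, c}"
      using card_subset_eq[of "{b, c}" "D d"] D_card[OF dV] bc(2) \<open>D d \<noteq> {b, c}\<close> by auto
    then have "a \<in> D d" using Dd by auto
    then obtain x where "D d = {a, x}" "a \<noteq> x" using D_pair[OF dV] by metis
    then show ?thesis using Dd by auto
  qed
  then show False using key[of b c] key[of c b] bc by (auto simp: insert_commute)
qed

text \<open>Some \<open>a\<close> in \<open>S\<close> has \<open>D a = {x, y}\<close> with
  \<open>y\<close> outside. As \<open>x\<close> misses a whole component, \<open>Nout x\<close> is
  exactly the component \<open>C\<close> of \<open>y\<close>. Removing \<open>x\<close> and
  \<open>C\<close> leaves three vertices against at least five components, where
  \<open>cover_three\<close> applies.\<close>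

lemma cut_size_four:
  assumes s: "card S = 4" and m: "card (f ` I) \<ge> 6"
    and star: "\<And>x. x \<in> S \<Longrightarrow> \<exists>k\<in>f ` I. \<forall>u\<in>I. f u = k \<longrightarrow> u \<in> N x"
  shows False
proof -
  have m4: "card (f ` I) \<ge> 4" using m by simp
  obtain a where a: "a \<in> S" "\<not> D a \<subseteq> S" using cut_size_four_not_all_inner[OF s] by blast
  then have aV: "a \<in> V" using SV by auto
  obtain x where x: "x \<in> S" "x \<in> D a" using D_meets_S[OF m4 aV] by blast
  obtain y where y: "D a = {x, y}" "y \<in> V" "a \<in> N x" "a \<in> N y" "x \<in> N a" "y \<in> N a"
    using D_pair[OF aV x(2)] by metis
  have yI: "y \<in> I" using a y x by auto
  define C where "C = {u \<in> I. f u = f y}"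
  have sub: "f ` Nout x \<subseteq> {f y}" using mixed_Nout_inner(1)[OF a(1) y(1) x(1) yI] .
  obtain k where k: "k \<in> f ` I" "\<And>u. u \<in> I \<Longrightarrow> f u = k \<Longrightarrow> u \<in> N x" using star[OF x(1)] by blast
  then obtain u where "u \<in> Nout x" "f u = k" unfolding Nout_def by blast
  then have "k = f y" using sub by blast
  then have WC: "Nout x = C" using k sub unfolding Nout_def C_def by blast
  define A where "A = I - C"
  have fA: "f ` A = f ` I - {f y}" unfolding A_def C_def by auto
  have "card (f ` A) = card (f ` I) - 1" using fA yI finI by simp
  then have cA: "card (f ` A) \<ge> 5" using m by simp
  let ?B = "S - {x}"
  have cB: "card ?B = 3" using s x finS by simp
  have nU: "\<And>z v. z \<in> S - ?B \<Longrightarrow> v \<in> A \<Longrightarrow> v \<notin> N z" using WC unfolding A_def Nout_def by auto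
  have AI: "A \<subseteq> I" by (auto simp: A_def)
  have cov: "card (f ` A) \<le> (\<Sum>z\<in>?B. card (f ` (Nout z \<inter> A)))"
    and q: "\<And>z. z \<in> ?B \<Longrightarrow> card (f ` Nout z) \<le> 2"
    using cover_three[OF AI _ nU cA cB] by auto
  have q': "card (f ` (Nout z \<inter> A)) \<le> 2" if "z \<in> ?B" for z
    using q[OF that] card_mono[of "f ` Nout z" "f ` (Nout z \<inter> A)"] finNout by fastforce
  have aB: "a \<in> ?B" using a D_irrefl[OF aV] x by auto
  have yW: "y \<in> Nout a" using y yI by (simp add: Nout_def)
  \<comment> \<open>One of the at most two labels of \<open>a\<close> is spent on \<open>C\<close>,
    because \<open>y\<close> is a non-neighbour of \<open>a\<close>. The remaining labels are then
    at most \<open>1 + 2 + 2\<close>, so again all bounds are attained and the labels of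
    \<open>a\<close> are disjoint from the others.\<close>
  have qa: "card (f ` (Nout a \<inter> A)) \<le> 1"
  proof -
    have "f y \<notin> f ` (Nout a \<inter> A)" using fA by blast
    moreover have "f y \<in> f ` Nout a" using yW by blast
    ultimately have "f ` (Nout a \<inter> A) \<subset> f ` Nout a" by blast
    then have "card (f ` (Nout a \<inter> A)) < card (f ` Nout a)" using finNout by (intro psubset_card_mono) auto
    then show ?thesis using q[OF aB] by simp
  qed
  have "card (?B - {a}) = 2" using cB aB finS by simp
  then obtain b c where "?B - {a} = {b, c}" and bc: "b \<noteq> c" by (auto simp: card_2_iff)
  then have B: "?B = {a, b, c}" and abc: "a \<noteq> b" "a \<noteq> c" using aB by auto
  have sum: "card (f ` A) \<le> card (f ` (Nout a \<inter> A)) + card (f ` (Nout b \<inter> A)) + card (f ` (Nout c \<inter> A))"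
    using cov B bc abc by (simp add: add.assoc)
  have ba: "b \<in> ?B" "c \<in> ?B" using B by auto
  have qb: "card (f ` (Nout b \<inter> A)) = 2" "card (f ` (Nout c \<inter> A)) = 2" "card (f ` (Nout a \<inter> A)) = 1" "card (f ` A) = 5"
    using sum qa q'[OF ba(1)] q'[OF ba(2)] cA by linarith+
  have "f ` (Nout a \<inter> A) \<noteq> {}" using qb(3) by auto
  have "f ` (Nout a \<inter> A) \<inter> f ` (Nout z \<inter> A) = {}" if z: "z = b \<or> z = c" for z
  proof -
    have "A \<subseteq> (\<Union>z\<in>?B. Nout z)"
    proof
      fix v assume v: "v \<in> A"
      then have vV: "v \<in> V" "v \<in> I" using AI by auto
      then obtain z where z: "z \<in> S" "z \<in> D v" using D_meets_S[OF m4] by blast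
      then have "v \<in> N z" using D_pair[OF vV(1)] by blast
      then show "v \<in> (\<Union>z\<in>?B. Nout z)" using z v vV nU[of z v] by (auto simp: Nout_def)
    qed
    then have "A = Nout a \<inter> A \<union> (Nout b \<inter> A \<union> Nout c \<inter> A)" unfolding B by auto
    then have "f ` A = f ` (Nout a \<inter> A) \<union> (f ` (Nout b \<inter> A) \<union> f ` (Nout c \<inter> A))" by (metis image_Un)
    then have c5: "card (f ` (Nout a \<inter> A) \<union> (f ` (Nout b \<inter> A) \<union> f ` (Nout c \<inter> A))) = 5" using qb by simp
    have fin: "finite (f ` (Nout x \<inter> A))" for x using finNout by simp
    have "card (f ` (Nout a \<inter> A) \<inter> (f ` (Nout b \<inter> A) \<union> f ` (Nout c \<inter> A))) = 0"
      using card_Un_Int[of "f ` (Nout a \<inter> A)" "f ` (Nout b \<inter> A) \<union> f ` (Nout c \<inter> A)"] fin c5 qb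
        card_Un_le[of "f ` (Nout b \<inter> A)" "f ` (Nout c \<inter> A)"] by auto
    then show ?thesis using fin z by auto
  qed
  note disjf = this
  obtain w where w: "w \<in> Nout a" "w \<in> A" using \<open>f ` (Nout a \<inter> A) \<noteq> {}\<close> by auto
  have w': "w \<notin> Nout z" if "z = b \<or> z = c" for z
  proof
    assume "w \<in> Nout z"
    then have "f w \<in> f ` (Nout a \<inter> A) \<inter> f ` (Nout z \<inter> A)" using w by simp
    then show False using disjf[OF that] by simp
  qed
  have "w \<notin> Nout z" if "z \<in> S" "z \<noteq> a" for z
  proof (cases "z = x")
    case True
    then show ?thesis using w WC by (auto simp: A_def)
  next
    case False
    then have "z \<in> ?B" using that by auto
    then show ?thesis using B that w' by auto
  qed
  then obtain y' where y': "D w = {a, y'}" "y' \<in> I" "y' \<noteq> w" "N a \<inter> N y' = {w}"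
    using sole_server[OF m4 w(1) a(1)] by metis
  have wI: "w \<in> I" using w AI by auto
  \<comment> \<open>\<open>y\<close> is in \<open>Nout a\<close> and differs from \<open>w\<close>,
    so it shares its component with \<open>y'\<close>. Then \<open>y'\<close> is in
    \<open>C\<close>, and \<open>x\<close> becomes a second common non-neighbour of \<open>a\<close>
    and \<open>y'\<close>.\<close>
  have "f y = f y'" using mixed_Nout[of w a y' y] y' yW a wI w yI by (auto simp: A_def C_def)
  then have "y' \<in> Nout x" using WC y' by (simp add: C_def)
  then have "x \<in> N y'" using N_sym x SV by (auto simp: Nout_def)
  then have "x \<in> {w}" using y(5) y'(4) by auto
  then show False using wI x by auto
qed

section \<open>Components missed entirely, and cuts with five vertices\<close>

definition missed :: "'a \<Rightarrow> 'b set" where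
  "missed x = {k \<in> f ` I. \<forall>u\<in>I. f u = k \<longrightarrow> u \<in> N x}"

lemma missed_sub: "missed x \<subseteq> f ` Nout x"
  unfolding missed_def Nout_def by auto

lemma missed_le: "card (missed x) \<le> card (f ` Nout x)"
  using missed_sub finNout by (intro card_mono) auto

text \<open>\<open>D\<close> injects \<open>A\<close> into the pairs of \<open>B\<close> that are
  not pairs of \<open>G\<close>; the sum on the left avoids truncated subtraction.\<close>

lemma card_D_between:
  assumes "A \<subseteq> V" "finite B" "G \<subseteq> B" "\<And>v. v \<in> A \<Longrightarrow> D v \<subseteq> B \<and> \<not> D v \<subseteq> G"
  shows "card A + (card G choose 2) \<le> card B choose 2"
proof -
  let ?P = "\<lambda>X. {Q. Q \<subseteq> X \<and> card Q = 2}"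
  have finG: "finite G" using assms finite_subset by blast
  have "card A = card (D ` A)" using D_inj assms(1) by (metis card_image inj_on_subset)
  also have "\<dots> \<le> card (?P B - ?P G)"
    using assms D_card by (intro card_mono) (auto intro: finite_subset[of _ "Pow B"])
  also have "\<dots> = card (?P B) - card (?P G)"
    using assms(2,3) finG by (intro card_Diff_subset) (auto intro: finite_subset[of _ "Pow G"])
  finally have "card A \<le> card (?P B) - card (?P G)" .
  moreover have "card (?P G) \<le> card (?P B)"
    using assms(2,3) by (intro card_mono) (auto intro: finite_subset[of _ "Pow B"])
  ultimately show ?thesis using n_subsets[OF assms(2)] n_subsets[OF finG] by simp
qed

text \<open>
  Now every \<open>x\<close> in \<open>S\<close> misses two components, so if it is the only element of \<open>S\<close> in some \<open>D v\<close>, its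
  non-neighbours outside \<open>S\<close> are \<open>v\<close>, as a component of its own, and one further component.  As
  \<open>card V \<noteq> p + 7\<close>, there is a single component \<open>C\<close> with more than one vertex.  The further component
  is a single vertex for \<open>x \<in> \<Delta>\<close> and \<open>C\<close> for \<open>x \<in> \<Gamma>\<close>.  The bounds \<open>b1\<close> and \<open>b2\<close> count all vertices
  and those outside \<open>S\<close>, by the pairs \<open>D v\<close> inside \<open>S\<close>, none of which lies inside \<open>\<Gamma>\<close>.
\<close>

lemma cut_size_five:
  assumes s: "card S = 5" and p: "p \<ge> 5" and m: "card (f ` I) \<ge> p + 2"
    and star: "\<And>x. x \<in> S \<Longrightarrow> card (f ` I) \<le> p + card (missed x)"
    and odd: "\<And>k. card (f ` I) = p + 2 \<Longrightarrow> k \<in> f ` I \<Longrightarrow> odd (card {u \<in> I. f u = k})"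
    and n: "card V \<noteq> p + 7"
  shows False
proof -
  have m4: "card (f ` I) \<ge> 4" using m p by simp
  define cl where "cl k = {u \<in> I. f u = k}" for k
  have fincl: "finite (cl k)" for k using finV by (simp add: cl_def)
  have two: "card (f ` Nout x) \<ge> 2" if "x \<in> S" for x
    using star[OF that] m missed_le[of x] by simp
  have DS: "D a \<subseteq> S" if a: "a \<in> S" for a
  proof (rule ccontr)
    have aV: "a \<in> V" using a SV by auto
    assume "\<not> D a \<subseteq> S"
    then obtain y where y: "y \<in> D a" "y \<notin> S" by blast
    obtain x where x: "x \<in> S" "x \<in> D a" using D_meets_S[OF m4 aV] by blast
    obtain y' where y': "D a = {x, y'}" "y' \<in> V" using D_pair[OF aV x(2)] by metis
    then have "y' \<in> I" using y x by auto
    then show False using mixed_Nout_inner(2)[OF a y'(1) x(1)] two[OF x(1)] by simp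
  qed
  have mixed: "Nout x = insert v (cl (f y)) \<and> cl (f v) = {v} \<and> f v \<noteq> f y \<and> card (f ` I) \<le> p + 2"
    if v: "v \<in> I" "D v = {x, y}" "x \<in> S" "y \<in> I" for v x y
  proof -
    have vV: "v \<in> V" using v by auto
    have "x \<noteq> y" using v by auto
    then have vU: "v \<in> N x" using D_Int[OF vV, of x y] v by auto
    have sub: "f ` Nout x \<subseteq> {f v, f y}" using mixed_Nout[OF vV v(2-4)] by auto
    have "card {f v, f y} \<le> 2" by (simp add: card_insert_if)
    then have eq: "f ` Nout x = {f v, f y}"
      using two[OF v(3)] sub card_seteq[of "{f v, f y}" "f ` Nout x"] by auto
    then have ne: "f v \<noteq> f y" using two[OF v(3)] by auto
    \<comment> \<open>Only two labels are available and two must be missed in full. So the component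
      of \<open>v\<close> lies inside \<open>Nout x\<close>, where \<open>v\<close> is the only
      vertex outside the component of \<open>y\<close>.\<close>
    have "card (missed x) \<ge> 2" using star[OF v(3)] m by simp
    then have miss: "missed x = {f v, f y}"
      using missed_sub[of x] eq card_seteq[of "{f v, f y}" "missed x"] ne by auto
    then have "card (f ` I) \<le> p + 2" using star[OF v(3)] ne by simp
    moreover have clW: "cl (f v) \<subseteq> Nout x" "cl (f y) \<subseteq> Nout x"
      using miss unfolding missed_def cl_def Nout_def by auto
    moreover have "u = v" if "u \<in> cl (f v)" for u
    proof (rule ccontr)
      assume "u \<noteq> v"
      then have "f u = f y" using mixed_Nout[OF vV v(2-4), of u] clW that by auto
      then show False using that ne by (simp add: cl_def)
    qed
    then have "cl (f v) = {v}" using v by (auto simp: cl_def)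
    moreover have "Nout x \<subseteq> insert v (cl (f y))"
      using mixed_Nout[OF vV v(2-4)] Nout_sub by (auto simp: cl_def)
    moreover have "v \<in> Nout x" using vU v by (simp add: Nout_def)
    ultimately show ?thesis using ne by auto
  qed
  define M where "M = {v \<in> I. \<not> D v \<subseteq> S}"
  have Mobt: "\<exists>x y. x \<in> S \<and> y \<in> I \<and> D v = {x, y} \<and> v \<in> Nout x" if "v \<in> M" for v
  proof -
    have vI: "v \<in> V" "v \<in> I" using that by (auto simp: M_def)
    obtain x where x: "x \<in> S" "x \<in> D v" using D_meets_S[OF m4 vI(1)] by blast
    obtain y where y: "D v = {x, y}" "y \<in> V" "v \<in> N x" using D_pair[OF vI(1) x(2)] by metis
    then have "y \<in> I" "v \<in> Nout x" using that vI x by (auto simp: M_def Nout_def)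
    then show ?thesis using x y by blast
  qed
  have mI: "card (f ` I) \<le> card I" using finI by (rule card_image_le)
  \<comment> \<open>Otherwise \<open>D\<close> embeds all vertices into the 10 pairs of
    \<open>S\<close>, while there are at least \<open>5 + p + 2\<close> vertices.\<close>
  have "M \<noteq> {}"
  proof
    assume "M = {}"
    then have "V = {v \<in> V. D v \<subseteq> S}" using DS by (auto simp: M_def)
    then have "card V \<le> 10" using card_D_subset_le[of V S] finS s by (simp add: numeral_eq_Suc)
    then show False using card_V s mI m p by simp
  qed
  then have m_eq: "card (f ` I) = p + 2" using Mobt mixed m M_def by (metis (no_types, lifting) antisym ex_in_conv mem_Collect_eq)
  have odd_cl: "odd (card (cl k))" if "k \<in> f ` I" for k
    using odd[OF m_eq that] by (simp add: cl_def)
  \<comment> \<open>This is where the excluded order enters: \<open>p + 7 = 5 + (p + 2)\<close>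
    would allow every component to be a single vertex.\<close>
  have "card I \<noteq> card (f ` I)" using n card_V s m_eq by simp
  then have "\<not> inj_on f I" using card_image by metis
  then obtain u u' where u: "u \<in> I" "u' \<in> I" "f u = f u'" "u \<noteq> u'" by (auto simp: inj_on_def)
  define C where "C = cl (f u)"
  have uC: "u \<in> C" using u by (simp add: C_def cl_def)
  have big: "card (cl k) \<ge> 3" if "a \<in> cl k" "b \<in> cl k" "a \<noteq> b" for a b k
  proof -
    have "k \<in> f ` I" using that by (auto simp: cl_def)
    moreover have "card {a, b} \<le> card (cl k)" using that fincl by (intro card_mono) auto
    ultimately show ?thesis using odd_cl[of k] that by (cases "card (cl k) = 2") auto
  qed
  have C3: "card C \<ge> 3" unfolding C_def using u by (intro big[of u _ u']) (auto simp: cl_def)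
  have CI: "C \<subseteq> I" by (auto simp: C_def cl_def)
  have MC: "cl (f v) = {v}" if "v \<in> M" for v
    using Mobt[OF that] mixed that M_def by blast
  have inner: "D v \<subseteq> S" if "v \<in> I" "v \<in> cl k" "card (cl k) \<noteq> 1" for v k
  proof (rule ccontr)
    assume "\<not> D v \<subseteq> S"
    then have "cl (f v) = {v}" using MC that by (simp add: M_def)
    then show False using that by (simp add: cl_def)
  qed
  define T where "T = {v \<in> V. D v \<subseteq> S}"
  have T10: "card T \<le> 10"
    using card_D_subset_le[of V S] finS s by (simp add: T_def numeral_eq_Suc)
  \<comment> \<open>Vertices of \<open>S\<close> and of large components have their pairs inside
    \<open>S\<close>; two large components, of odd size at least 3, would give
    \<open>5 + 3 + 3 > 10\<close> such vertices.\<close>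
  have unique: "cl k = C" if "k \<in> f ` I" "card (cl k) \<noteq> 1" for k
  proof (rule ccontr)
    assume "cl k \<noteq> C"
    then have dis: "cl k \<inter> C = {}" by (auto simp: C_def cl_def)
    have "cl k \<noteq> {}" using that by (auto simp: cl_def)
    then obtain a where a: "a \<in> cl k" by blast
    have "cl k \<noteq> {a}" using that by auto
    then obtain b where "b \<in> cl k" "a \<noteq> b" using a by blast
    then have "card (cl k) \<ge> 3" using big a by blast
    moreover have "S \<union> (cl k \<union> C) \<subseteq> T"
    proof -
      have "cl k \<subseteq> T" using inner[of _ k] that by (auto simp: T_def cl_def)
      moreover have "C \<subseteq> T" using inner[of _ "f u"] C3 by (auto simp: T_def C_def cl_def)
      moreover have "S \<subseteq> T" using DS SV by (auto simp: T_def)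
      ultimately show ?thesis by auto
    qed
    then have "card (S \<union> (cl k \<union> C)) \<le> 10"
      using T10 card_mono[of T "S \<union> (cl k \<union> C)"] finV by (simp add: T_def)
    moreover have "card (S \<union> (cl k \<union> C)) = card S + (card (cl k) + card C)"
      using finS fincl dis CI unfolding C_def
      by (subst card_Un_disjoint; (subst card_Un_disjoint)?) (auto simp: cl_def)
    ultimately show False using s C3 by simp
  qed
  have cI: "card I \<ge> p + 4"
  proof -
    have "f ` (I - C) = f ` I - {f u}" by (auto simp: C_def cl_def)
    then have "card (f ` (I - C)) = p + 1" using m_eq u finI by simp
    then have "card (I - C) \<ge> p + 1" using card_image_le[of "I - C" f] finI by simp
    moreover have "card I = card (I - C) + card C"
      using CI finI finite_subset card_mono by (subst card_Diff_subset) (auto simp: C_def fincl card_mono)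
    ultimately show ?thesis using C3 by simp
  qed
  define \<Delta> where "\<Delta> = {x \<in> S. \<exists>v\<in>I. \<exists>y\<in>I. D v = {x, y} \<and> card (Nout x) = 2}"
  define \<Gamma> where "\<Gamma> = {x \<in> S. \<exists>v\<in>I. \<exists>y\<in>I. D v = {x, y} \<and> card (Nout x) \<noteq> 2}"
  have \<Delta>Nout: "card (Nout x) = 2 \<and> Nout x \<inter> C = {}" if x: "x \<in> \<Delta>" for x
  proof -
    obtain v y where v: "x \<in> S" "v \<in> I" "y \<in> I" "D v = {x, y}" "card (Nout x) = 2"
      using x unfolding \<Delta>_def by blast
    then have Nout: "Nout x = insert v (cl (f y))" "cl (f v) = {v}" "f v \<noteq> f y" using mixed by auto
    then have "v \<notin> cl (f y)" by (auto simp: cl_def)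
    then have "card (cl (f y)) = 1" using Nout v fincl by simp
    moreover have "card (cl (f v)) = 1" using Nout(2) by simp
    ultimately have ne: "f y \<noteq> f u" "f v \<noteq> f u" using C3 by (auto simp: C_def)
    have "Nout x \<inter> C = {}"
    proof (rule ccontr)
      assume "Nout x \<inter> C \<noteq> {}"
      then obtain w where "w \<in> Nout x" "w \<in> C" by blast
      then show False using ne Nout(1) by (auto simp: C_def cl_def)
    qed
    then show ?thesis using v by simp
  qed
  have \<Gamma>Nout: "C \<subseteq> Nout x \<and> card (Nout x - C) \<le> 1" if x: "x \<in> \<Gamma>" for x
  proof -
    obtain v y where v: "x \<in> S" "v \<in> I" "y \<in> I" "D v = {x, y}" "card (Nout x) \<noteq> 2"
      using x unfolding \<Gamma>_def by blast
    then have Nout: "Nout x = insert v (cl (f y))" "cl (f v) = {v}" "f v \<noteq> f y" using mixed by auto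
    then have "v \<notin> cl (f y)" by (auto simp: cl_def)
    then have "card (cl (f y)) \<noteq> 1" using Nout v fincl by simp
    then have "cl (f y) = C" using unique v by blast
    then have "Nout x - C \<subseteq> {v}" "C \<subseteq> Nout x" using Nout by auto
    then show ?thesis using card_mono[of "{v}" "Nout x - C"] by simp
  qed
  let ?N = "(\<Union>x\<in>\<Delta>. Nout x) \<union> (\<Union>x\<in>\<Gamma>. Nout x - C)"
  have fin: "finite \<Delta>" "finite \<Gamma>" "\<Delta> \<subseteq> S" "\<Gamma> \<subseteq> S" "\<Delta> \<inter> \<Gamma> = {}"
    using finS unfolding \<Delta>_def \<Gamma>_def by auto
  have cardN: "card ?N \<le> 2 * card \<Delta> + card \<Gamma>"
  proof -
    have "card ?N \<le> card (\<Union>x\<in>\<Delta>. Nout x) + card (\<Union>x\<in>\<Gamma>. Nout x - C)" by (rule card_Un_le)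
    moreover have "card (\<Union>x\<in>\<Delta>. Nout x) \<le> (\<Sum>x\<in>\<Delta>. card (Nout x))" using fin by (intro card_UN_le)
    moreover have "(\<Sum>x\<in>\<Delta>. card (Nout x)) = 2 * card \<Delta>" using \<Delta>Nout by simp
    moreover have "card (\<Union>x\<in>\<Gamma>. Nout x - C) \<le> (\<Sum>x\<in>\<Gamma>. card (Nout x - C))" using fin by (intro card_UN_le)
    moreover have "(\<Sum>x\<in>\<Gamma>. card (Nout x - C)) \<le> (\<Sum>x\<in>\<Gamma>. 1)" using \<Gamma>Nout by (intro sum_mono) auto
    ultimately show ?thesis by simp
  qed
  have finN: "finite ?N" using fin finNout by auto
  have MN: "M \<subseteq> ?N"
  proof
    fix v assume v: "v \<in> M"
    then obtain x y where xy: "x \<in> S" "y \<in> I" "D v = {x, y}" "v \<in> Nout x" using Mobt by blast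
    have vI: "v \<in> I" using v by (simp add: M_def)
    have "v \<notin> C"
    proof
      assume "v \<in> C"
      then have "cl (f v) = C" by (auto simp: C_def cl_def)
      then have "C = {v}" using MC[OF v] by simp
      then have "card C = 1" by simp
      then show False using C3 by simp
    qed
    moreover have "x \<in> \<Delta> \<or> x \<in> \<Gamma>" using xy vI unfolding \<Delta>_def \<Gamma>_def by blast
    ultimately show "v \<in> ?N" using xy by blast
  qed
  \<comment> \<open>Two members of \<Gamma> have all of \<open>C\<close>, at least three vertices,
    as common non-neighbours.\<close>
  have not\<Gamma>: "\<not> D v \<subseteq> \<Gamma>" if v: "v \<in> V" for v
  proof
    assume sub: "D v \<subseteq> \<Gamma>"
    obtain x where "x \<in> D v" using D_nonempty v by blast
    then obtain y where xy: "D v = {x, y}" "N x \<inter> N y = {v}" using D_pair v by metis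
    then have "x \<in> \<Gamma>" "y \<in> \<Gamma>" using sub by simp_all
    then have "C \<subseteq> Nout x" "C \<subseteq> Nout y" using \<Gamma>Nout by blast+
    then have "C \<subseteq> N x \<inter> N y" unfolding Nout_def by blast
    then have "C \<subseteq> {v}" using xy(2) by simp
    then show False using C3 card_mono[of "{v}" C] by simp
  qed
  let ?e = "card \<Delta>" and ?g = "card \<Gamma>"
  have b1: "card V + (?g choose 2) \<le> 10 + 2 * ?e + ?g"
  proof -
    have "card T + (?g choose 2) \<le> card S choose 2"
    proof (rule card_D_between)
      show "T \<subseteq> V" by (simp add: T_def)
      show "D v \<subseteq> S \<and> \<not> D v \<subseteq> \<Gamma>" if "v \<in> T" for v
        using that not\<Gamma> unfolding T_def by blast
    qed (use finS fin in auto)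
    then have "card T + (?g choose 2) \<le> 5 choose 2" by (simp only: s)
    moreover have "V = T \<union> M" using DS by (auto simp: T_def M_def)
    then have "card V \<le> card T + card M" using card_Un_le[of T M] by simp
    moreover have "card M \<le> 2 * ?e + ?g" using MN finN cardN card_mono by (meson order_trans)
    moreover have "5 choose 2 = (10::nat)" by (simp add: numeral_eq_Suc)
    ultimately show ?thesis by linarith
  qed
  have b2: "card I + (?g choose 2) \<le> 2 * ?e + ?g + (5 - ?e choose 2)"
  proof -
    let ?R = "{v \<in> I. D v \<subseteq> S - \<Delta>}"
    have "card ?R + (?g choose 2) \<le> card (S - \<Delta>) choose 2"
    proof (rule card_D_between)
      show "D v \<subseteq> S - \<Delta> \<and> \<not> D v \<subseteq> \<Gamma>" if "v \<in> ?R" for v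
        using that not\<Gamma> by blast
    qed (use finS fin in auto)
    moreover have "card (S - \<Delta>) = 5 - ?e" using fin s by (simp add: card_Diff_subset)
    \<comment> \<open>If \<open>D v\<close> lies in \<open>S\<close> and meets \<Delta> in
      \<open>x\<close>, then \<open>v\<close> is in \<open>Nout x\<close>; so only pairs inside
      \<open>S - \<Delta>\<close> need counting separately.\<close>
    moreover have "I \<subseteq> ?N \<union> ?R"
    proof
      fix v assume v: "v \<in> I"
      show "v \<in> ?N \<union> ?R"
      proof (cases "v \<in> M")
        case True
        then show ?thesis using MN by blast
      next
        case False
        then have "D v \<subseteq> S" using v by (simp add: M_def)
        show ?thesis
        proof (cases "D v \<subseteq> S - \<Delta>")
          case True
          then show ?thesis using v by simp
        next
          case False
          then obtain x where x: "x \<in> D v" "x \<in> \<Delta>" using \<open>D v \<subseteq> S\<close> by blast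
          then have "v \<in> N x" using D_pair[of v x] v by blast
          then have "v \<in> Nout x" using v by (simp add: Nout_def)
          then show ?thesis using x by blast
        qed
      qed
    qed
    then have "card I \<le> card (?N \<union> ?R)" using finN finV by (intro card_mono) auto
    then have "card I \<le> card ?N + card ?R" using card_Un_le[of ?N ?R] by simp
    ultimately show ?thesis using cardN by simp
  qed
  \<comment> \<open>The pair of the vertex \<open>u\<close> of \<open>C\<close> has a member outside
    \<Gamma>; it misses \<open>u\<close>, so it is not in \<Delta> either.\<close>
  have "?e + ?g < 5"
  proof -
    have uV: "u \<in> V" using u by auto
    have Du: "D u \<subseteq> S" using inner[of u "f u"] uC C3 CI by (auto simp: C_def)
    obtain r where r: "r \<in> D u" "r \<notin> \<Gamma>" using not\<Gamma>[OF uV] by blast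
    have "u \<in> N r" using D_pair[OF uV r(1)] by blast
    then have "u \<in> Nout r" using u by (simp add: Nout_def)
    then have "r \<notin> \<Delta>" using \<Delta>Nout uC by blast
    then have "\<Delta> \<union> \<Gamma> \<subset> S" using r Du fin by blast
    then have "card (\<Delta> \<union> \<Gamma>) < card S" using finS by (rule psubset_card_mono[rotated])
    then show ?thesis using card_Un_disjoint[of \<Delta> \<Gamma>] fin s by simp
  qed
  then have "?e = 0 \<or> ?e = 1 \<or> ?e = 2 \<or> ?e = 3 \<or> ?e = 4" "?g = 0 \<or> ?g = 1 \<or> ?g = 2 \<or> ?g = 3 \<or> ?g = 4"
    by auto
  \<comment> \<open>In the finite check \<open>b1\<close> excludes \<open>?e \<le> 1\<close> and
    \<open>b2\<close> excludes \<open>?e \<ge> 2\<close>.\<close>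
  moreover have "card V \<ge> 14" "card I \<ge> 9" using card_V s cI p by auto
  ultimately show False using b1 b2 \<open>?e + ?g < 5\<close> unfolding choose_two by (elim disjE) simp_all
qed

end

section \<open>Cuts with at least six vertices\<close>

lemma Mantel:
  assumes fin: "finite S" and ed: "\<And>e. e \<in> Ed \<Longrightarrow> e \<subseteq> S \<and> card e = 2"
    and tri: "\<And>x y z. {x, y} \<in> Ed \<Longrightarrow> {y, z} \<in> Ed \<Longrightarrow> {x, z} \<in> Ed \<Longrightarrow> False"
  shows "4 * card Ed \<le> card S * card S"
proof (cases "S = {}")
  case True
  have "Ed = {}"
  proof (rule ccontr)
    assume "Ed \<noteq> {}"
    then obtain e where "e \<in> Ed" by auto
    then have "e = {}" "card e = 2" using ed True by auto
    then show False by simp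
  qed
  then show ?thesis by simp
next
  case False
  define nb where "nb x = {y \<in> S. {x, y} \<in> Ed}" for x
  have finnb: "finite (nb x)" for x using fin by (simp add: nb_def)
  define d where "d = Max ((\<lambda>x. card (nb x)) ` S)"
  have "d \<in> (\<lambda>x. card (nb x)) ` S" using fin False unfolding d_def by (intro Max_in) auto
  then obtain x where x: "x \<in> S" "card (nb x) = d" by auto
  have dmax: "card (nb y) \<le> d" if "y \<in> S" for y
    using fin that unfolding d_def by (intro Max_ge) auto
  \<comment> \<open>\<open>x\<close> has maximum degree \<open>d\<close> and its neighbours span no
    edge, so each edge has an end among the \<open>card S - d\<close> other vertices, each of degree
    at most \<open>d\<close>.\<close>
  have "Ed \<subseteq> (\<Union>y\<in>S - nb x. (\<lambda>z. {y, z}) ` nb y)"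
  proof
    fix e assume e: "e \<in> Ed"
    then obtain a b where ab: "e = {a, b}" "a \<in> S" "b \<in> S" using ed[OF e] by (auto simp: card_2_iff)
    have "a \<notin> nb x \<or> b \<notin> nb x"
      using tri[of x a b] e ab by (auto simp: nb_def insert_commute)
    moreover have "e \<in> (\<lambda>z. {a, z}) ` nb a" "e \<in> (\<lambda>z. {b, z}) ` nb b"
      using e ab by (auto simp: nb_def insert_commute)
    ultimately show "e \<in> (\<Union>y\<in>S - nb x. (\<lambda>z. {y, z}) ` nb y)" using ab by blast
  qed
  then have "card Ed \<le> card (\<Union>y\<in>S - nb x. (\<lambda>z. {y, z}) ` nb y)"
    using fin finnb by (intro card_mono) auto
  also have "\<dots> \<le> (\<Sum>y\<in>S - nb x. card ((\<lambda>z. {y, z}) ` nb y))" using fin by (intro card_UN_le) auto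
  also have "\<dots> \<le> (\<Sum>y\<in>S - nb x. d)"
    using dmax finnb by (intro sum_mono) (meson DiffD1 card_image_le order_trans)
  also have "\<dots> = card (S - nb x) * d" by simp
  also have "card (S - nb x) = card S - d"
    using x finnb by (subst card_Diff_subset) (auto simp: nb_def)
  finally have le: "card Ed \<le> (card S - d) * d" .
  have "d \<le> card S" using x fin card_mono[of S "nb x"] by (auto simp: nb_def)
  then obtain j where j: "card S = d + j" using le_Suc_ex by blast
  have "4 * (j * d) \<le> (d + j) * (d + j)"
  proof -
    have "0 \<le> (int d - int j) * (int d - int j)" by simp
    then have "4 * (int j * int d) \<le> (int d + int j) * (int d + int j)" by (simp add: algebra_simps)
    then show ?thesis by (metis of_nat_add of_nat_le_iff of_nat_mult of_nat_numeral)
  qed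
  then show ?thesis using le j by simp
qed

context critical_cut begin

text \<open>A member of \<open>S\<close> whose partner is outside has at most two labels, hence
  misses at most two components.\<close>

lemma large_inner:
  assumes "\<And>x. x \<in> S \<Longrightarrow> card (missed x) \<ge> 3" "card (f ` I) \<ge> 4" "v \<in> V"
  shows "D v \<subseteq> S"
proof (rule ccontr)
  assume "\<not> D v \<subseteq> S"
  then obtain y where y: "y \<in> D v" "y \<notin> S" by blast
  obtain x where x: "x \<in> S" "x \<in> D v" using D_meets_S[OF assms(2,3)] by blast
  obtain y' where y': "D v = {x, y'}" "y' \<in> V" using D_pair[OF assms(3) x(2)] by metis
  then have "y' \<in> I" using y x by auto
  then have "card (f ` Nout x) \<le> 2"
    using mixed_Nout_inner(2)[of v x y'] mixed_Nout_outer[of v x y'] y' x assms(3) by fastforce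
  then show False using assms(1)[OF x(1)] missed_le[of x] by simp
qed

text \<open>A component missed by both members consists of common non-neighbours, so it can only be
  \<open>{v}\<close>.\<close>

lemma missed_Int:
  assumes "v \<in> V" "D v = {x, y}" "x \<noteq> y"
  shows "missed x \<inter> missed y \<subseteq> {f v}" "v \<in> S \<Longrightarrow> missed x \<inter> missed y = {}"
proof -
  have N: "N x \<inter> N y = {v}" using D_Int[OF assms(1), of x y] assms by auto
  have *: "\<exists>u\<in>I. f u = k \<and> u = v" if k: "k \<in> missed x \<inter> missed y" for k
  proof -
    obtain u where u: "u \<in> I" "f u = k" using k unfolding missed_def by blast
    then have "u \<in> N x \<inter> N y" using k unfolding missed_def by blast
    then show ?thesis using u N by blast
  qed
  then show "missed x \<inter> missed y \<subseteq> {f v}" by blast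
  show "missed x \<inter> missed y = {}" if "v \<in> S" using * that by blast
qed

definition Nin :: "'a \<Rightarrow> 'a set" where "Nin v = N v \<inter> S"

lemma finNin: "finite (Nin v)"
  using finS by (simp add: Nin_def)

text \<open>By \<open>D_private\<close> the only \<open>D w\<close> inside \<open>Nin v\<close> is
  \<open>D v\<close>. All other pairs of \<open>Nin v\<close> belong to the few pairs
  \<open>F\<close> that \<open>D\<close> does not hit, so \<open>Nin v\<close> must be small when
  \<open>V\<close> is large.\<close>

lemma pairs_in_Nin:
  assumes DS: "\<And>v. v \<in> V \<Longrightarrow> D v \<subseteq> S" and v: "v \<in> V"
  defines "F \<equiv> {Q. Q \<subseteq> S \<and> card Q = 2} - D ` V"
  shows "D v \<subseteq> Nin v" "{Q. Q \<subseteq> Nin v \<and> card Q = 2} - {D v} \<subseteq> F" "finite F"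
    "card F = (card S choose 2) - card V" "card V \<le> card S choose 2"
    "(card (Nin v) choose 2) + card V \<le> (card S choose 2) + 1"
proof -
  let ?A = "{Q. Q \<subseteq> S \<and> card Q = 2}"
  have finA: "finite ?A" using finS by (auto intro: finite_subset[of _ "Pow S"])
  show finF: "finite F" using finA by (simp add: F_def)
  show DP: "D v \<subseteq> Nin v" using D_sub_N[OF v] DS[OF v] by (simp add: Nin_def)
  show sub: "{Q. Q \<subseteq> Nin v \<and> card Q = 2} - {D v} \<subseteq> F"
  proof
    fix Q assume Q: "Q \<in> {Q. Q \<subseteq> Nin v \<and> card Q = 2} - {D v}"
    have "Q \<noteq> D w" if "w \<in> V" for w
      using D_private[OF v that] Q by (auto simp: Nin_def)
    then show "Q \<in> F" using Q by (auto simp: F_def Nin_def)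
  qed
  have DA: "D ` V \<subseteq> ?A" using DS D_card by auto
  have cA: "card ?A = card S choose 2" using finS by (rule n_subsets)
  have cD: "card (D ` V) = card V" using D_inj by (rule card_image)
  show le: "card V \<le> card S choose 2" using card_mono[OF finA DA] cA cD by simp
  show cF: "card F = (card S choose 2) - card V"
    using DA finV cA cD unfolding F_def by (subst card_Diff_subset) auto
  have "card ({Q. Q \<subseteq> Nin v \<and> card Q = 2} - {D v}) \<le> card F" using finF sub by (rule card_mono)
  moreover have "card ({Q. Q \<subseteq> Nin v \<and> card Q = 2} - {D v}) = (card (Nin v) choose 2) - 1"
    using DP D_card[OF v] n_subsets[OF finNin] by (subst card_Diff_singleton) auto
  ultimately show "(card (Nin v) choose 2) + card V \<le> (card S choose 2) + 1"
    using cF le by simp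
qed

text \<open>\<open>A\<close> consists of one representative of each component.\<close>

lemma sum_Nin_ge:
  assumes "\<And>x. x \<in> S \<Longrightarrow> card (missed x) \<ge> z"
  shows "\<exists>A\<subseteq>I. card A = card (f ` I) \<and> card S * z \<le> (\<Sum>v\<in>A. card (Nin v))"
proof -
  obtain r where r: "\<And>k. k \<in> f ` I \<Longrightarrow> r k \<in> I \<and> f (r k) = k"
    by (metis (no_types, lifting) image_iff)
  let ?A = "r ` (f ` I)"
  have "inj_on r (f ` I)" using r by (metis inj_onI)
  then have cA: "card ?A = card (f ` I)" by (rule card_image)
  have finA: "finite ?A" using finI by simp
  have "card S * z \<le> (\<Sum>x\<in>S. card (missed x))"
    using assms sum_mono[of S "\<lambda>_. z" "\<lambda>x. card (missed x)"] by simp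
  also have "\<dots> \<le> (\<Sum>x\<in>S. card {v \<in> ?A. x \<in> Nin v})"
  proof (rule sum_mono)
    fix x assume x: "x \<in> S"
    have "missed x \<subseteq> f ` {v \<in> ?A. x \<in> Nin v}"
    proof
      fix k assume k: "k \<in> missed x"
      then have rk: "r k \<in> I" "f (r k) = k" "k \<in> f ` I" using r by (auto simp: missed_def)
      then have "r k \<in> N x" using k by (simp add: missed_def)
      then have "x \<in> Nin (r k)" using N_sym x SV by (auto simp: Nin_def)
      then have "r k \<in> {v \<in> ?A. x \<in> Nin v}" using rk(3) by auto
      then show "k \<in> f ` {v \<in> ?A. x \<in> Nin v}" using rk(2) by (intro image_eqI[of k f "r k"]) simp_all
    qed
    then have "card (missed x) \<le> card (f ` {v \<in> ?A. x \<in> Nin v})" using finA by (intro card_mono) auto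
    also have "\<dots> \<le> card {v \<in> ?A. x \<in> Nin v}" using finA by (intro card_image_le) auto
    finally show "card (missed x) \<le> card {v \<in> ?A. x \<in> Nin v}" .
  qed
  \<comment> \<open>Double counting of the non-adjacent pairs between \<open>S\<close> and the
    representatives.\<close>
  also have "\<dots> = (\<Sum>x\<in>S. \<Sum>v\<in>?A. if x \<in> Nin v then 1 else 0)"
    using finA by (intro sum.cong) (simp_all add: sum.If_cases Int_def)
  also have "\<dots> = (\<Sum>v\<in>?A. \<Sum>x\<in>S. if x \<in> Nin v then 1 else 0)" by (rule sum.swap)
  also have "\<dots> = (\<Sum>v\<in>?A. card (Nin v))"
    using finS by (intro sum.cong refl) (simp add: sum.If_cases Nin_def Int_commute)
  finally show ?thesis using cA r by (intro exI[of _ ?A]) auto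
qed

text \<open>Each \<open>x\<close> in \<open>S\<close> misses at least \<open>m - p\<close> of the
  \<open>m\<close> components. The members of \<open>D a\<close> with \<open>a\<close> in
  \<open>S\<close> miss disjoint sets, so \<open>2 * (m - p) \<le> m\<close>. If the pairs
  \<open>D v\<close>, read as edges on \<open>S\<close>, contain a triangle, its vertices miss sets
  with pairwise intersections of size at most 1, so \<open>3 * (m - p) \<le> m + 3\<close>;
  otherwise Mantel's theorem applies.\<close>

lemma inner_bounds:
  assumes DS: "\<And>v. v \<in> V \<Longrightarrow> D v \<subseteq> S" and S: "S \<noteq> {}"
    and star: "\<And>x. x \<in> S \<Longrightarrow> card (f ` I) \<le> p + card (missed x)"
  shows "card (f ` I) \<le> 2 * p"
    "4 * card V \<le> card S * card S \<or> 2 * card (f ` I) \<le> 3 * p + 3"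
proof -
  let ?m = "card (f ` I)"
  have finm: "finite (missed x)" for x
    using finI by (rule_tac finite_subset[of _ "f ` I"]) (auto simp: missed_def)
  have subm: "missed x \<subseteq> f ` I" for x by (auto simp: missed_def)
  obtain a where a: "a \<in> S" using S by blast
  then have aV: "a \<in> V" using SV by auto
  obtain x where x: "x \<in> D a" using D_nonempty aV by blast
  obtain y where xy: "D a = {x, y}" "x \<noteq> y" using D_pair[OF aV x] by metis
  have "card (missed x \<union> missed y) = card (missed x) + card (missed y)"
    using missed_Int(2)[OF aV xy a] finm by (intro card_Un_disjoint) auto
  moreover have "card (missed x \<union> missed y) \<le> ?m" using finI subm by (intro card_mono) auto
  moreover have "x \<in> S" "y \<in> S" using DS[OF aV] xy by auto
  ultimately show "?m \<le> 2 * p" using star[of x] star[of y] by simp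
  have small: "card (missed x \<inter> missed y) \<le> 1" if xyD: "{x, y} \<in> D ` V" for x y
  proof -
    obtain v where v: "v \<in> V" "D v = {x, y}" using xyD by (metis imageE)
    have "x \<noteq> y" using D_card[OF v(1)] v(2) by auto
    then have "missed x \<inter> missed y \<subseteq> {f v}" using missed_Int(1) v by metis
    then show ?thesis using card_mono[of "{f v}" "missed x \<inter> missed y"] by simp
  qed
  show "4 * card V \<le> card S * card S \<or> 2 * ?m \<le> 3 * p + 3"
  proof (cases "\<exists>x y z. {x, y} \<in> D ` V \<and> {y, z} \<in> D ` V \<and> {x, z} \<in> D ` V")
    case True
    then obtain x y z where xyz: "{x, y} \<in> D ` V" "{y, z} \<in> D ` V" "{x, z} \<in> D ` V" by blast
    have inS: "x \<in> S" "y \<in> S" "z \<in> S" using xyz DS by auto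
    have "card (missed x \<union> missed y) + 1 \<ge> card (missed x) + card (missed y)"
      using card_Un_Int[of "missed x" "missed y"] finm small[OF xyz(1)] by simp
    moreover have "card ((missed x \<union> missed y) \<inter> missed z) \<le> 2"
      using small[OF xyz(2)] small[OF xyz(3)]
        card_Un_le[of "missed x \<inter> missed z" "missed y \<inter> missed z"] by (simp add: Int_Un_distrib2)
    then have "card (missed x \<union> missed y \<union> missed z) + 2 \<ge> card (missed x \<union> missed y) + card (missed z)"
      using card_Un_Int[of "missed x \<union> missed y" "missed z"] finm by simp
    moreover have "card (missed x \<union> missed y \<union> missed z) \<le> ?m"
      using finI subm by (intro card_mono) auto
    ultimately have "card (missed x) + card (missed y) + card (missed z) \<le> ?m + 3" by simp
    then show ?thesis using star[OF inS(1)] star[OF inS(2)] star[OF inS(3)] by simp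
  next
    case False
    have "4 * card (D ` V) \<le> card S * card S"
    proof (rule Mantel[OF finS])
      show "e \<subseteq> S \<and> card e = 2" if "e \<in> D ` V" for e using that DS D_card by auto
    qed (use False in blast)
    then show ?thesis using card_image[OF D_inj] by simp
  qed
qed

text \<open>
  A set \<open>Nin v\<close> with three elements contains two pairs that are no \<open>D w\<close>, and is their union; there
  are at most four such pairs.
\<close>

lemma cut_size_seven_odd:
  assumes DS: "\<And>v. v \<in> V \<Longrightarrow> D v \<subseteq> S" and s: "card S = 7" and n: "card V \<ge> 17"
    and A: "A \<subseteq> V" "card A = 10" and sum: "28 \<le> (\<Sum>v\<in>A. card (Nin v))"
  shows False
proof -
  define F where "F = {Q. Q \<subseteq> S \<and> card Q = 2} - D ` V"
  have finA: "finite A" using A finV finite_subset by blast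
  \<comment> \<open>Four elements would require \<open>6 + 17 \<le> 21 + 1\<close>.\<close>
  have P3: "card (Nin v) \<le> 3" if v: "v \<in> V" for v
  proof (rule ccontr)
    assume "\<not> card (Nin v) \<le> 3"
    then have "4 choose 2 \<le> card (Nin v) choose 2" by (intro binomial_right_mono) auto
    then show False using pairs_in_Nin(6)[OF DS v] s n by (simp add: choose_two)
  qed
  define B where "B = {v \<in> A. card (Nin v) = 3}"
  define G where "G v = {Q. Q \<subseteq> Nin v \<and> card Q = 2} - {D v}" for v
  have "(\<Sum>v\<in>A. card (Nin v)) \<le> (\<Sum>v\<in>A. 2 + (if card (Nin v) = 3 then 1 else 0))"
  proof (rule sum_mono)
    fix v assume "v \<in> A"
    then have "card (Nin v) \<le> 3" using P3 A by blast
    then show "card (Nin v) \<le> 2 + (if card (Nin v) = 3 then 1 else 0)" by simp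
  qed
  also have "\<dots> = (\<Sum>v\<in>A. 2) + (\<Sum>v\<in>A. if card (Nin v) = 3 then 1 else 0)" by (rule sum.distrib)
  also have "(\<Sum>v\<in>A. if card (Nin v) = 3 then 1 else 0) = card B"
    using finA by (simp add: sum.If_cases B_def Int_def)
  also have "(\<Sum>v\<in>A. 2) + card B = 20 + card B" using A by simp
  finally have "card B \<ge> 8" using sum by simp
  moreover have "card B \<le> card F choose 2"
  proof (rule card_subsets2_le)
    obtain v where "v \<in> V" using n by (metis card.empty equals0I not_numeral_le_zero)
    then show "finite F" using pairs_in_Nin(3)[OF DS] by (simp add: F_def)
    have eq: "\<Union>(G v) = Nin v \<and> card (G v) = 2 \<and> G v \<subseteq> F" if v: "v \<in> B" for v
    proof -
      have vV: "v \<in> V" using v A by (auto simp: B_def)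
      obtain a where "a \<in> D v" using D_nonempty vV by blast
      then obtain b where ab: "D v = {a, b}" "a \<noteq> b" using D_pair vV by metis
      have "card (Nin v - {a, b}) = 1"
        using v pairs_in_Nin(1)[OF DS vV] ab by (subst card_Diff_subset) (auto simp: B_def)
      then obtain t where t: "Nin v - {a, b} = {t}" using card_1_singletonE by blast
      then have Pv: "Nin v = {a, b, t}" "t \<noteq> a" "t \<noteq> b" using pairs_in_Nin(1)[OF DS vV] ab by auto
      have "G v = {{a, t}, {b, t}}"
      proof
        show "G v \<subseteq> {{a, t}, {b, t}}"
        proof
          fix Q assume "Q \<in> G v"
          then have Q: "Q \<subseteq> {a, b, t}" "card Q = 2" "Q \<noteq> {a, b}"
            using Pv ab by (simp_all add: G_def)
          then obtain c d where cd: "Q = {c, d}" "c \<noteq> d" by (metis card_2_iff)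
          then have "c \<in> {a, b, t}" "d \<in> {a, b, t}" using Q by blast+
          with cd Q(3) show "Q \<in> {{a, t}, {b, t}}" by auto
        qed
        show "{{a, t}, {b, t}} \<subseteq> G v" using Pv ab by (auto simp: G_def doubleton_eq_iff)
      qed
      moreover have "{a, t} \<noteq> {b, t}" using ab by (auto simp: doubleton_eq_iff)
      moreover have "G v \<subseteq> F" using pairs_in_Nin(2)[OF DS vV] by (simp add: G_def F_def)
      ultimately show ?thesis using Pv by auto
    qed
    \<comment> \<open>\<open>Nin v\<close> is recovered as the union of \<open>G v\<close>, and
      vertices with equal \<open>Nin\<close> coincide by \<open>D_private\<close>. So at most
      \<open>4 choose 2 = 6\<close> vertices are in \<open>B\<close>, against the 8
      required.\<close>
    show "inj_on G B"
    proof (rule inj_onI)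
      fix v w assume vw: "v \<in> B" "w \<in> B" "G v = G w"
      then have "Nin v = Nin w" using eq by metis
      moreover have V: "v \<in> V" "w \<in> V" using vw A by (auto simp: B_def)
      ultimately have "D w \<subseteq> N v" using pairs_in_Nin(1)[OF DS V(2)] by (auto simp: Nin_def)
      then show "v = w" using D_private V by blast
    qed
    show "finite B" using finA by (simp add: B_def)
    show "G v \<subseteq> F \<and> card (G v) = 2" if "v \<in> B" for v using eq[OF that] by simp
  qed
  moreover have "card F \<le> 4"
  proof -
    obtain v where "v \<in> V" using n by (metis card.empty equals0I not_numeral_le_zero)
    then show ?thesis using pairs_in_Nin(4)[OF DS] s n by (simp add: F_def choose_two)
  qed
  then have "card F choose 2 \<le> 4 choose 2" by (rule binomial_right_mono)
  ultimately show False by (simp add: choose_two)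
qed

text \<open>The average over \<open>A\<close> exceeds 3, so some \<open>Nin v\<close> has four
  elements, and its five pairs other than \<open>D v\<close> exhaust \<open>F\<close>. A further
  \<open>Nin w\<close> with three elements would have its two pairs of \<open>F\<close> inside
  \<open>Nin v\<close>, hence \<open>D w\<close> too. The sum is then at most
  \<open>4 + 8 * 2 < 28\<close>.\<close>

lemma cut_size_seven_even:
  assumes DS: "\<And>v. v \<in> V \<Longrightarrow> D v \<subseteq> S" and s: "card S = 7" and n: "card V \<ge> 16"
    and A: "A \<subseteq> V" "card A = 9" and sum: "28 \<le> (\<Sum>v\<in>A. card (Nin v))"
  shows False
proof -
  define F where "F = {Q. Q \<subseteq> S \<and> card Q = 2} - D ` V"
  have finA: "finite A" using A finV finite_subset by blast
  have P4: "card (Nin v) \<le> 4" if v: "v \<in> V" for v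
  proof (rule ccontr)
    assume "\<not> card (Nin v) \<le> 4"
    then have "5 choose 2 \<le> card (Nin v) choose 2" by (intro binomial_right_mono) auto
    then show False using pairs_in_Nin(6)[OF DS v] s n by (simp add: choose_two)
  qed
  have "\<exists>v\<in>A. card (Nin v) > 3"
  proof (rule ccontr)
    assume "\<not> ?thesis"
    then have "(\<Sum>v\<in>A. card (Nin v)) \<le> (\<Sum>v\<in>A. 3)" by (intro sum_mono) (auto simp: not_less)
    then show False using sum A by simp
  qed
  then obtain v where "v \<in> A" "card (Nin v) > 3" by blast
  moreover have "card (Nin v) \<le> 4" using P4 A calculation by blast
  ultimately have v: "v \<in> A" "card (Nin v) = 4" by simp_all
  then have vV: "v \<in> V" using A by auto
  let ?G = "{Q. Q \<subseteq> Nin v \<and> card Q = 2} - {D v}"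
  have "card ?G = 5"
    using pairs_in_Nin(1)[OF DS vV] D_card[OF vV] n_subsets[OF finNin, of v 2] v
    by (subst card_Diff_singleton) (auto simp: choose_two)
  moreover have "card F \<le> 5" using pairs_in_Nin(4)[OF DS vV] s n by (simp add: F_def choose_two)
  moreover have "?G \<subseteq> F" "finite F" using pairs_in_Nin(2,3)[OF DS vV] by (auto simp: F_def)
  ultimately have "?G = F" by (intro card_seteq) simp_all
  then have FG: "F = ?G" by (rule sym)
  have P2: "card (Nin w) \<le> 2" if w: "w \<in> A - {v}" for w
  proof (rule ccontr)
    assume big: "\<not> card (Nin w) \<le> 2"
    have wV: "w \<in> V" using w A by auto
    obtain a where "a \<in> D w" using D_nonempty wV by blast
    then obtain b where ab: "D w = {a, b}" "a \<noteq> b" using D_pair wV by metis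
    have abP: "a \<in> Nin w" "b \<in> Nin w" using pairs_in_Nin(1)[OF DS wV] ab by auto
    have "\<not> Nin w \<subseteq> {a, b}" using big card_mono[of "{a, b}" "Nin w"] ab by auto
    then obtain t where t: "t \<in> Nin w" "t \<noteq> a" "t \<noteq> b" by blast
    have ne: "{a, t} \<noteq> {a, b}" "{b, t} \<noteq> {a, b}" using t ab(2) by (auto simp: doubleton_eq_iff)
    have "{a, t} \<in> {Q. Q \<subseteq> Nin w \<and> card Q = 2} - {D w}" "{b, t} \<in> {Q. Q \<subseteq> Nin w \<and> card Q = 2} - {D w}"
      unfolding ab(1) using t abP ne by auto
    then have "{a, t} \<in> F" "{b, t} \<in> F"
      using pairs_in_Nin(2)[OF DS wV] unfolding F_def by blast+
    then have "a \<in> Nin v" "b \<in> Nin v" unfolding FG by simp_all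
    then have "D w \<subseteq> Nin v" using ab(1) by simp
    then have "v = w" using D_private[OF vV wV] by (simp add: Nin_def)
    then show False using w by simp
  qed
  have "(\<Sum>w\<in>A. card (Nin w)) = card (Nin v) + (\<Sum>w\<in>A - {v}. card (Nin w))"
    using finA v by (simp add: sum.remove)
  also have "(\<Sum>w\<in>A - {v}. card (Nin w)) \<le> (\<Sum>w\<in>A - {v}. 2)" using P2 by (intro sum_mono) auto
  finally show False using sum v A finA by simp
qed

lemma cut_size_ge_six:
  assumes s: "card S \<ge> 6" and p: "p = 5 \<or> p = 6" and m: "card (f ` I) + 3 \<ge> card S + p"
    and star: "\<And>x. x \<in> S \<Longrightarrow> card (f ` I) \<le> p + card (missed x)"
    and ev: "p = 5 \<Longrightarrow> even (card V)"
  shows "p = 6 \<and> card S = 6 \<and> card V = 15 \<and> card (f ` I) = 9 \<and> (\<forall>v\<in>V. N v \<inter> S = D v)"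
proof -
  let ?m = "card (f ` I)" and ?s = "card S" and ?n = "card V"
  have miss: "card (missed x) \<ge> ?s - 3" if "x \<in> S" for x using star[OF that] m by simp
  have DS: "D v \<subseteq> S" if "v \<in> V" for v
    using that miss s m p by (intro large_inner) fastforce+
  have "S \<noteq> {}" using s by auto
  note bounds = inner_bounds[OF DS this star]
  have mI: "?m \<le> card I" using finI by (rule card_image_le)
  have n_ge: "?n \<ge> ?s + ?m" using card_V mI by simp
  \<comment> \<open>From \<open>?s + p - 3 \<le> ?m \<le> 2 * p\<close> follows
    \<open>?s \<le> p + 3\<close>.\<close>
  have s9: "?s = 6 \<or> ?s = 7 \<or> ?s = 8 \<or> ?s = 9" using bounds(1) m s p by auto
  \<comment> \<open>\<open>?n\<close> is at least \<open>2 * ?s + p - 3\<close>. The closest case is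
    \<open>?s = 9\<close>, possible only for \<open>p = 6\<close>, where
    \<open>4 * 21 > 81\<close>.\<close>
  have "\<not> 4 * ?n \<le> ?s * ?s"
    using s9 n_ge m p bounds(1) by (elim disjE) simp_all
  then have m2: "2 * ?m \<le> 3 * p + 3" using bounds(2) by simp
  obtain a where a: "a \<in> V" using \<open>S \<noteq> {}\<close> SV by blast
  have n_le: "?n \<le> ?s choose 2" using pairs_in_Nin(5)[OF DS a] .
  obtain A where A: "A \<subseteq> I" "card A = ?m" and sum: "?s * (?s - 3) \<le> (\<Sum>v\<in>A. card (Nin v))"
    using sum_Nin_ge[OF miss] by blast
  have AV: "A \<subseteq> V" using A by blast
  \<comment> \<open>Here the bounds leave exactly \<open>?m = 9\<close> for \<open>p = 5\<close> and
    \<open>?m = 10\<close> for \<open>p = 6\<close>; the 28 is \<open>7 * (7 - 3)\<close>.\<close>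
  have "?s \<noteq> 7"
  proof
    assume s7: "?s = 7"
    then have sum28: "28 \<le> (\<Sum>v\<in>A. card (Nin v))" using sum by simp
    from p show False
    proof
      assume "p = 5"
      then have "?m = 9" using m m2 s7 by simp
      then show False using cut_size_seven_even[OF DS s7 _ AV _ sum28] A n_ge s7 by simp
    next
      assume "p = 6"
      then have "?m = 10" using m m2 s7 by simp
      then show False using cut_size_seven_odd[OF DS s7 _ AV _ sum28] A n_ge s7 by simp
    qed
  qed
  moreover have "?s \<le> 7" using m m2 p by auto
  ultimately have s6: "?s = 6" using s by simp
  have n15: "?n \<le> 15" using n_le s6 by (simp add: choose_two)
  have n14: "?n \<ge> 14" using n_ge m s6 p by auto
  have P2: "card (Nin v) \<le> 2" if v: "v \<in> V" for v
  proof (rule ccontr)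
    assume "\<not> card (Nin v) \<le> 2"
    then have "3 choose 2 \<le> card (Nin v) choose 2" by (intro binomial_right_mono) auto
    then show False using pairs_in_Nin(6)[OF DS v] s6 n14 by (simp add: choose_two)
  qed
  \<comment> \<open>Parity leaves 14 vertices and 8 components, and \<open>6 * 3\<close> exceeds
    \<open>8 * 2\<close>.\<close>
  have "p \<noteq> 5"
  proof
    assume p5: "p = 5"
    have "?n \<noteq> 15" using ev[OF p5] by auto
    then have "?m = 8" using n15 n_ge m s6 p5 by simp
    have "(\<Sum>v\<in>A. card (Nin v)) \<le> (\<Sum>v\<in>A. 2)" using P2 AV by (intro sum_mono) auto
    then show False using sum s6 A \<open>?m = 8\<close> by simp
  qed
  then have p6: "p = 6" using p by simp
  then have "?m = 9" "?n = 15" using n15 n_ge m s6 by simp_all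
  moreover have "N v \<inter> S = D v" if v: "v \<in> V" for v
    using card_seteq[OF finNin pairs_in_Nin(1)[OF DS v]] P2[OF v] D_card[OF v] by (simp add: Nin_def)
  ultimately show ?thesis using p6 s6 by blast
qed

end

section \<open>Graphs\<close>

lemma finite_components:
  assumes "fin_digraph G"
  shows "finite (components G)"
proof -
  interpret fin_digraph G by fact
  have sub: "subgraph C G" if "C \<in> components G" for C
    using that by (simp add: components_def max_subgraph_def)
  have "inj_on (\<lambda>C. (verts C, arcs C)) (components G)"
  proof (rule inj_onI)
    fix C C' assume "C \<in> components G" "C' \<in> components G" "(verts C, arcs C) = (verts C', arcs C')"
    moreover have "tail C = tail C'" "head C = head C'"
      using sub[of C] sub[of C'] calculation by (simp_all add: subgraph_def compatible_def)
    ultimately show "C = C'" by (intro pre_digraph.equality) simp_all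
  qed
  moreover have "(\<lambda>C. (verts C, arcs C)) ` components G \<subseteq> Pow (verts G) \<times> Pow (arcs G)"
    using sub by (auto simp: subgraph_def)
  then have "finite ((\<lambda>C. (verts C, arcs C)) ` components G)" by (rule finite_subset) simp
  ultimately show ?thesis using finite_image_iff by blast
qed

context fin_digraph begin

lemma dominating_card_ge:
  assumes "domination_number G = k" "dominating_set G S"
  shows "k \<le> card S"
proof -
  have "finite {S. dominating_set G S}"
    by (rule finite_subset[of _ "Pow (verts G)"]) (auto simp: dominating_set_def)
  then show ?thesis using assms unfolding domination_number_def by (metis (mono_tags, lifting) Min_le finite_imageI image_eqI mem_Collect_eq)
qed

lemma dominating_set_attains:
  "\<exists>S. dominating_set G S \<and> card S = domination_number G"
proof -
  have "finite {S. dominating_set G S}"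
    by (rule finite_subset[of _ "Pow (verts G)"]) (auto simp: dominating_set_def)
  moreover have "dominating_set G (verts G)" by (simp add: dominating_set_def)
  ultimately have "domination_number G \<in> card ` {S. dominating_set G S}"
    unfolding domination_number_def by (intro Min_in) auto
  then show ?thesis by auto
qed

end

context graph begin

section \<open>Components, matchings and critical pairs in a graph\<close>

abbreviation E :: "'a rel" where "E \<equiv> arcs_ends G"

lemma sym_E: "sym E"
  using sym_arcs by (simp add: symmetric_def)

lemma irrefl_E: "irrefl E"
  using adj_not_same by (auto simp: irrefl_def)

lemma E_verts: "(u, v) \<in> E \<Longrightarrow> u \<in> verts G \<and> v \<in> verts G"
  using adj_in_verts by blast

lemma reach_class_eq_reachable:
  assumes "u \<in> verts G"
  shows "reach_class E (verts G) u = {v. u \<rightarrow>\<^sup>* v}"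
proof -
  have "Restr E (verts G) = E" using E_verts by auto
  moreover have "u \<rightarrow>\<^sup>* v" if "(u, v) \<in> E\<^sup>*" "v \<in> verts G" for v
    unfolding reachable_def using that assms E_verts
    by (intro rtrancl_consistent_rtrancl_on) auto
  ultimately show ?thesis
    by (auto simp: reach_class_def intro: reachable_rtranclI elim: reachable_in_vertsE)
qed

text \<open>A connected subgraph containing \<open>u\<close> stays among the vertices reachable from
  \<open>u\<close> because adjacency is symmetric, and the induced subgraph already has all arcs
  between them; so it is maximal.\<close>

lemma induced_reachable_in_components:
  assumes u: "u \<in> verts G"
  shows "G \<restriction> {v. u \<rightarrow>\<^sup>* v} \<in> components G"
proof -
  let ?R = "{v. u \<rightarrow>\<^sup>* v}" and ?C = "G \<restriction> {v. u \<rightarrow>\<^sup>* v}"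
  have RV: "?R \<subseteq> verts G" by (auto elim: reachable_in_vertsE)
  have sub: "subgraph ?C G" using RV by (rule subgraph_induce_subgraphI)
  interpret C: wf_digraph ?C by (rule wellformed_induce_subgraph)
  have "?C \<in> sccs" using u by (rule induce_reachable_is_in_sccs)
  then have "strongly_connected ?C" by (simp add: sccs_def)
  then have con: "connected ?C"
    using C.reachable_mk_symmetricI unfolding connected_def strongly_connected_def
    by (simp add: mk_symmetric_def)
  have "H = ?C" if H: "subgraph ?C H" "subgraph H G" "connected H" for H
  proof -
    have "u \<in> verts H" using H(1) u by (auto simp: subgraph_def)
    have "subgraph (mk_symmetric H) (mk_symmetric G)" using H(2) by (rule subgraph_mk_symmetric)
    have "verts H \<subseteq> ?R"
    proof
      fix v assume "v \<in> verts H"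
      then have "u \<rightarrow>\<^sup>*\<^bsub>with_proj (mk_symmetric H)\<^esub> v"
        using H(3) \<open>u \<in> verts H\<close> by (auto simp: connected_def strongly_connected_def mk_symmetric_def)
      then have "u \<rightarrow>\<^sup>*\<^bsub>with_proj (mk_symmetric G)\<^esub> v"
        using \<open>subgraph (mk_symmetric H) (mk_symmetric G)\<close> by (rule pre_digraph.reachable_mono)
      then show "v \<in> ?R" using reachable_mk_symmetric_eq[OF sym_arcs] by simp
    qed
    then have V: "verts H = ?R" using H(1) by (auto simp: subgraph_def)
    interpret H: wf_digraph H using H(2) by (simp add: subgraph_def)
    have th: "tail H = tail G" "head H = head G" using H(2) by (auto simp: subgraph_def compatible_def)
    have "arcs H \<subseteq> arcs ?C"
    proof
      fix a assume a: "a \<in> arcs H"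
      then have "tail H a \<in> ?R" "head H a \<in> ?R" using V H.tail_in_verts H.head_in_verts by blast+
      moreover have "a \<in> arcs G" using a H(2) by (auto simp: subgraph_def)
      ultimately show "a \<in> arcs ?C" using th by simp
    qed
    then have "arcs H = arcs ?C" using H(1) by (auto simp: subgraph_def)
    then show ?thesis using V th by (intro pre_digraph.equality) simp_all
  qed
  then have "max_subgraph connected ?C"
    using sub con unfolding max_subgraph_def by blast
  then show ?thesis by (simp add: components_def)
qed

text \<open>Links the hypothesis on odd components to the classes of the Tutte--Berge formula for
  the empty cut.\<close>

lemma card_odd_classes_le: "card (odd_classes E (verts G)) \<le> num_odd_components G"
  unfolding num_odd_components_def
proof (rule card_inj_on_le[where f = "induce_subgraph G"])
  show "inj_on (induce_subgraph G) (odd_classes E (verts G))"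
    by (rule inj_onI) (metis induce_subgraph_verts)
  show "induce_subgraph G ` odd_classes E (verts G) \<subseteq> {C \<in> components G. odd (card (verts C))}"
    using induced_reachable_in_components reach_class_eq_reachable by (auto simp: odd_classes_def)
  show "finite {C \<in> components G. odd (card (verts C))}"
    using finite_components[OF fin_digraph_axioms] by simp
qed

lemma set_matching_iff: "set_matching E (verts G) M \<longleftrightarrow> matching G M"
proof -
  have "{{u, v} | u v. (u, v) \<in> E \<and> u \<in> verts G \<and> v \<in> verts G} = {{u, v} | u v. (u, v) \<in> E}"
    using E_verts by blast
  then show ?thesis by (simp add: set_matching_def matching_def)
qed

lemma Tutte_Berge_graph:
  obtains M S where "matching G M" "S \<subseteq> verts G" "\<Union>M \<subseteq> verts G"
    "card (verts G) = 2 * card M + card (verts G - \<Union>M)"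
    "card (verts G - \<Union>M) + card S \<le> card (odd_classes E (verts G - S))"
proof -
  obtain M S where MS: "set_matching E (verts G) M" "S \<subseteq> verts G"
    "card (verts G) + card S \<le> 2 * card M + card (odd_classes E (verts G - S))"
    using Tutte_Berge[OF finite_verts sym_E irrefl_E] by blast
  have c: "card (verts G) = 2 * card M + card (verts G - \<Union>M)"
    using set_matching_card(2)[OF finite_verts irrefl_E MS(1)] .
  then have "card (verts G - \<Union>M) + card S \<le> card (odd_classes E (verts G - S))" using MS by simp
  moreover have "matching G M" using MS set_matching_iff by simp
  ultimately show ?thesis using that c MS(2) set_matching_Union_subset[OF MS(1)] by blast
qed

text \<open>The number of uncovered vertices is nonzero and has the parity of the order, hence is at
  least 2. In the odd case below it is odd and not 1, hence at least 3.\<close>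

lemma no_perfect_matching:
  assumes "even (card (verts G))" "\<not> (\<exists>M. perfect_matching G M)"
  obtains S where "S \<subseteq> verts G" "card S + 2 \<le> card (odd_classes E (verts G - S))"
proof -
  obtain M S where MS: "matching G M" "S \<subseteq> verts G" "\<Union>M \<subseteq> verts G"
    "card (verts G) = 2 * card M + card (verts G - \<Union>M)"
    "card (verts G - \<Union>M) + card S \<le> card (odd_classes E (verts G - S))"
    by (rule Tutte_Berge_graph)
  have "\<Union>M \<noteq> verts G" using assms MS by (auto simp: perfect_matching_def)
  then have "verts G - \<Union>M \<noteq> {}" using MS by blast
  then have "card (verts G - \<Union>M) \<noteq> 0" by simp
  moreover have "even (card (verts G - \<Union>M))" using assms(1) MS(4) by (metis dvd_triv_left even_add)
  ultimately have "card (verts G - \<Union>M) \<ge> 2" by presburger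
  then show ?thesis using that MS by simp
qed

lemma no_near_perfect_matching:
  assumes "odd (card (verts G))" "\<not> (\<exists>M. near_perfect_matching G M)"
  obtains S where "S \<subseteq> verts G" "card S + 3 \<le> card (odd_classes E (verts G - S))"
proof -
  obtain M S where MS: "matching G M" "S \<subseteq> verts G" "\<Union>M \<subseteq> verts G"
    "card (verts G) = 2 * card M + card (verts G - \<Union>M)"
    "card (verts G - \<Union>M) + card S \<le> card (odd_classes E (verts G - S))"
    by (rule Tutte_Berge_graph)
  have "card (verts G - \<Union>M) \<noteq> 1"
  proof
    assume "card (verts G - \<Union>M) = 1"
    then obtain v where "verts G - \<Union>M = {v}" using card_1_singletonE by blast
    then have "v \<in> verts G" "\<Union>M = verts G - {v}" using MS by auto
    then show False using assms MS by (auto simp: near_perfect_matching_def)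
  qed
  moreover have "odd (card (verts G - \<Union>M))" using assms(1) MS(4) by (metis dvd_triv_left even_add)
  ultimately have "card (verts G - \<Union>M) \<ge> 3" by presburger
  then show ?thesis using that MS by simp
qed

text \<open>\<open>x\<close> is left out because a vertex dominates itself; otherwise two
  non-adjacent members of \<open>D v\<close> would be common non-neighbours of the pair.\<close>

definition non_adj :: "'a \<Rightarrow> 'a set" where
  "non_adj x = {u \<in> verts G. u \<noteq> x \<and> (x, u) \<notin> E}"

lemma adj_del_vert: "(x, y) \<in> arcs_ends (del_vert v) \<longleftrightarrow> (x, y) \<in> E \<and> x \<noteq> v \<and> y \<noteq> v"
  by (auto simp: arcs_ends_def arc_to_ends_def del_vert_simps)

text \<open>A minimum dominating set of \<open>G - v\<close> has at most two members, and adding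
  \<open>v\<close> must give at least three. None of its members is adjacent to \<open>v\<close>, or
  it would dominate \<open>G\<close>.\<close>

lemma critical_pair:
  assumes crit: "gamma_vertex_critical 3 G" and v: "v \<in> verts G"
  shows "\<exists>D\<subseteq>verts G. card D = 2 \<and>
           (\<forall>x\<in>D. \<forall>y\<in>D. x \<noteq> y \<longrightarrow> non_adj x \<inter> non_adj y = {v})"
proof -
  interpret d: fin_digraph "del_vert v" by (rule fin_digraph_del_vert)
  have dom3: "domination_number G = 3" using crit by (simp add: gamma_vertex_critical_def)
  obtain D where D: "dominating_set (del_vert v) D" "card D = domination_number (del_vert v)"
    using d.dominating_set_attains by blast
  then have le2: "card D \<le> 2" using crit v dom3 by (auto simp: gamma_vertex_critical_def)
  have DV: "D \<subseteq> verts G" "v \<notin> D" using D(1) by (auto simp: dominating_set_def del_vert_simps)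
  have finD: "finite D" using DV(1) finite_verts by (rule finite_subset)
  have cov: "w \<in> D \<or> (\<exists>u\<in>D. (w, u) \<in> E)" if "w \<in> verts G" "w \<noteq> v" for w
    using D(1) that by (auto simp: dominating_set_def del_vert_simps adj_del_vert)
  have "dominating_set G (insert v D)"
    using cov DV v by (auto simp: dominating_set_def)
  then have "3 \<le> card (insert v D)" using dominating_card_ge[OF dom3] by blast
  then have card2: "card D = 2" using le2 DV finD by simp
  have nv: "(v, u) \<notin> E" if "u \<in> D" for u
  proof
    assume "(v, u) \<in> E"
    then have "dominating_set G D"
      using cov DV that unfolding dominating_set_def by blast
    then show False using dominating_card_ge[OF dom3] card2 by fastforce
  qed
  have "non_adj x \<inter> non_adj y = {v}" if xy: "x \<in> D" "y \<in> D" "x \<noteq> y" for x y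
  proof -
    have Dxy: "D = {x, y}" using card2 xy finD card_seteq[of D "{x, y}"] by auto
    have "w = v" if w: "w \<in> non_adj x" "w \<in> non_adj y" for w
    proof (rule ccontr)
      assume "w \<noteq> v"
      then have "w \<in> D \<or> (\<exists>u\<in>D. (w, u) \<in> E)" using cov w by (auto simp: non_adj_def)
      moreover have "(w, x) \<notin> E" "(w, y) \<notin> E" "w \<noteq> x" "w \<noteq> y"
        using w sym_E unfolding non_adj_def sym_def by blast+
      ultimately show False unfolding Dxy by simp
    qed
    moreover have "v \<in> non_adj x" "v \<in> non_adj y"
      using nv[OF xy(1)] nv[OF xy(2)] xy v DV sym_E unfolding non_adj_def sym_def by blast+
    ultimately show ?thesis by blast
  qed
  then show ?thesis using DV card2 by blast
qed

lemma star_free_neighbours: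
  assumes free: "star_free r G" and x: "x \<in> verts G"
    and L: "L \<subseteq> {u. (x, u) \<in> E}" "\<And>u w. u \<in> L \<Longrightarrow> w \<in> L \<Longrightarrow> (u, w) \<notin> E"
  shows "card L \<noteq> r"
proof
  assume r: "card L = r"
  have LV: "L \<subseteq> verts G" "x \<notin> L" using L E_verts irrefl_E by (auto simp: irrefl_def)
  let ?H = "G \<restriction> (insert x L)"
  have ind: "induced_subgraph ?H G" using LV x by (intro induced_induce) auto
  have "arcs_ends ?H = E \<inter> (insert x L \<times> insert x L)"
    by (auto simp: arcs_ends_def arc_to_ends_def)
  also have "\<dots> = {x} \<times> L \<union> L \<times> {x}"
    using L sym_E irrefl_E unfolding sym_def irrefl_def by blast
  finally have ends: "arcs_ends ?H = {x} \<times> L \<union> L \<times> {x}" .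
  interpret H: digraph ?H using ind by (rule digraphI_induced)
  interpret H: sym_digraph ?H using ind by (rule induced_graph_imp_graph)
  have "graph ?H" by unfold_locales
  moreover have "verts ?H = {x} \<union> L" "{x} \<inter> L = {}" "card {x} = 1" using LV by simp_all
  ultimately have "complete_bipartite_digraph 1 r ?H"
    unfolding complete_bipartite_digraph_def using r ends by blast
  then show False using free ind unfolding star_free_def by blast
qed

section \<open>Isomorphisms onto the exceptional graphs\<close>

lemma digraph_iso_pairI:
  fixes H :: "'c pair_pre_digraph"
  assumes inj: "inj_on h (verts G)" and img: "h ` verts G = pverts H"
    and arcs: "map_prod h h ` E = parcs H"
  shows "digraph_iso G (with_proj H)"
proof -
  let ?f = "\<lparr>iso_verts = h, iso_arcs = \<lambda>a. (h (tail G a), h (head G a)), iso_head = snd, iso_tail = fst\<rparr>"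
  \<comment> \<open>Arcs of the target are pairs of vertices, so an arc goes to the pair of images
    of its ends; this is injective since there are no parallel arcs.\<close>
  have "inj_on (\<lambda>a. (h (tail G a), h (head G a))) (arcs G)"
  proof (rule inj_onI)
    fix a a' assume a: "a \<in> arcs G" "a' \<in> arcs G"
      and eq: "(h (tail G a), h (head G a)) = (h (tail G a'), h (head G a'))"
    then have "tail G a = tail G a'" "head G a = head G a'"
      using inj by (auto dest: inj_onD)
    then show "a = a'" using no_multi_arcs a by (simp add: arc_to_ends_def)
  qed
  then have "digraph_isomorphism ?f"
    using inj wf_digraph_axioms by (simp add: digraph_isomorphism_def)
  moreover have "(\<lambda>a. (h (tail G a), h (head G a))) ` arcs G = parcs H"
    unfolding arcs[symmetric] arcs_ends_def arc_to_ends_def image_image by simp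
  then have "with_proj H = app_iso ?f G"
    using img by (intro pre_digraph.equality) simp_all
  ultimately show ?thesis unfolding digraph_iso_def by blast
qed

lemma iso_graph_A:
  assumes S: "S \<subseteq> verts G" "card S = 3"
    and w: "\<And>x. x \<in> S \<Longrightarrow> card (w x) = 2" "verts G - S = (\<Union>x\<in>S. w x)"
      "\<And>x y. x \<in> S \<Longrightarrow> y \<in> S \<Longrightarrow> x \<noteq> y \<Longrightarrow> w x \<inter> w y = {}"
    and SS: "\<And>s t. s \<in> S \<Longrightarrow> t \<in> S \<Longrightarrow> (s, t) \<notin> E"
    and II: "\<And>s t. s \<in> verts G - S \<Longrightarrow> t \<in> verts G - S \<Longrightarrow> (s, t) \<notin> E"
    and SI: "\<And>s t. s \<in> S \<Longrightarrow> t \<in> verts G - S \<Longrightarrow> (s, t) \<in> E \<longleftrightarrow> t \<notin> w s"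
  shows "digraph_iso G (with_proj graph_A)"
proof -
  obtain x1 x2 x3 where x: "S = {x1, x2, x3}" "x1 \<noteq> x2" "x1 \<noteq> x3" "x2 \<noteq> x3"
    using S(2) by (auto simp: card_3_iff)
  obtain c1 c2 where c12: "w x1 = {c1, c2}" "c1 \<noteq> c2" using w(1)[of x1] x by (auto simp: card_2_iff)
  obtain c3 c4 where c34: "w x2 = {c3, c4}" "c3 \<noteq> c4" using w(1)[of x2] x by (auto simp: card_2_iff)
  obtain c5 c6 where c56: "w x3 = {c5, c6}" "c5 \<noteq> c6" using w(1)[of x3] x by (auto simp: card_2_iff)
  have I: "verts G - S = {c1, c2, c3, c4, c5, c6}" using w(2) x c12 c34 c56 by auto
  have V: "verts G = {x1, x2, x3, c1, c2, c3, c4, c5, c6}" using I x S(1) by blast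
  have disj: "{c1, c2} \<inter> {c3, c4} = {}" "{c1, c2} \<inter> {c5, c6} = {}" "{c3, c4} \<inter> {c5, c6} = {}"
    using w(3)[of x1 x2] w(3)[of x1 x3] w(3)[of x2 x3] x c12 c34 c56 by simp_all
  have xc: "S \<inter> {c1, c2, c3, c4, c5, c6} = {}" using I by blast
  have ne: "distinct [x1, x2, x3, c1, c2, c3, c4, c5, c6]" using disj xc x c12(2) c34(2) c56(2) by auto
  define X where "X = {x1} \<times> {c3, c4, c5, c6} \<union> {x2} \<times> {c1, c2, c5, c6} \<union> {x3} \<times> {c1, c2, c3, c4}"
  have SX: "(s, t) \<in> X \<longleftrightarrow> t \<notin> w s" if "s \<in> S" "t \<in> verts G - S" for s t
  proof -
    have "s = x1 \<or> s = x2 \<or> s = x3" "t \<in> {c1, c2, c3, c4, c5, c6}" using that x I by auto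
    then show ?thesis using ne c12 c34 c56 by (elim disjE) (auto simp: X_def)
  qed
  have XSI: "X \<subseteq> S \<times> (verts G - S)" unfolding X_def I unfolding x(1) by auto
  have EX: "E = X \<union> X\<inverse>"
  proof (intro set_eqI, clarify)
    fix s t
    have sym: "(s, t) \<in> E \<longleftrightarrow> (t, s) \<in> E" using sym_E by (auto simp: sym_def)
    show "(s, t) \<in> E \<longleftrightarrow> (s, t) \<in> X \<union> X\<inverse>"
    proof (cases "s \<in> verts G \<and> t \<in> verts G")
      case False
      then show ?thesis using E_verts[of s t] XSI S(1) by auto
    next
      case True
      then show ?thesis using SX[of s t] SX[of t s] SI[of s t] SI[of t s] SS[of s t] II[of s t] sym XSI
        by (cases "s \<in> S"; cases "t \<in> S") auto
    qed
  qed
  define h where "h t = (if t = x1 then U else if t = x2 then V else if t = x3 then W else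
    if t = c1 then C1 else if t = c2 then C2 else if t = c3 then C3 else
    if t = c4 then C4 else if t = c5 then C5 else C6)" for t
  have h: "h x1 = U" "h x2 = V" "h x3 = W" "h c1 = C1" "h c2 = C2" "h c3 = C3" "h c4 = C4" "h c5 = C5" "h c6 = C6"
    using ne by (auto simp: h_def)
  show ?thesis
  proof (rule digraph_iso_pairI)
    show "inj_on h (verts G)" unfolding V by (auto simp: h)
    show "h ` verts G = pverts graph_A" unfolding V graph_A_def by (simp add: h)
    have "map_prod h h ` X = {U} \<times> {C3, C4, C5, C6} \<union> {V} \<times> {C1, C2, C5, C6} \<union> {W} \<times> {C1, C2, C3, C4}" (is "_ = ?Y")
      unfolding X_def by (simp add: image_Un h)
    moreover have "map_prod h h ` (X\<inverse>) = (map_prod h h ` X)\<inverse>" by force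
    ultimately have "map_prod h h ` E = ?Y \<union> ?Y\<inverse>" unfolding EX image_Un by simp
    then show "map_prod h h ` E = parcs graph_A" by (simp add: graph_A_def Let_def)
  qed
qed

text \<open>Since \<open>6 choose 2 = 15\<close>, the injective \<open>D\<close> hits every pair of
  \<open>S\<close>. The pairs of vertices in \<open>S\<close> are the sets of non-neighbours within
  \<open>S\<close>, so the outer vertices correspond to the remaining pairs.\<close>

lemma iso_graph_B:
  assumes S: "S \<subseteq> verts G" "card S = 6" and n: "card (verts G) = 15"
    and D: "\<And>v. v \<in> verts G \<Longrightarrow> D v \<subseteq> S \<and> card (D v) = 2" "inj_on D (verts G)"
    and SS: "\<And>s t. s \<in> S \<Longrightarrow> t \<in> S \<Longrightarrow> (s, t) \<in> E \<longleftrightarrow> s \<noteq> t \<and> t \<notin> D s" "\<And>s. s \<in> S \<Longrightarrow> s \<notin> D s"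
    and II: "\<And>s t. s \<in> verts G - S \<Longrightarrow> t \<in> verts G - S \<Longrightarrow> (s, t) \<notin> E"
    and SI: "\<And>s t. s \<in> S \<Longrightarrow> t \<in> verts G - S \<Longrightarrow> (s, t) \<in> E \<longleftrightarrow> s \<notin> D t"
    and h: "bij_betw h S (pverts H)" "parcs H \<subseteq> pverts H \<times> pverts H"
      "\<And>s t. s \<in> S \<Longrightarrow> t \<in> S \<Longrightarrow> (h s, h t) \<in> parcs H \<longleftrightarrow> (s, t) \<in> E"
  shows "digraph_iso G (with_proj (graph_B H))"
proof -
  let ?V = "verts G" and ?I = "verts G - S"
  have finS: "finite S" using S by (auto intro: finite_subset)
  have hinj: "inj_on h S" and himg: "h ` S = pverts H" using h(1) by (auto simp: bij_betw_def)
  have hmem: "h s \<in> h ` A \<longleftrightarrow> s \<in> A" if "s \<in> S" "A \<subseteq> S" for s A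
    using hinj that by (rule inj_on_image_mem_iff)
  have heq: "h ` A = h ` B \<longleftrightarrow> A = B" if "A \<subseteq> S" "B \<subseteq> S" for A B
    using hinj that by (rule inj_on_image_eq_iff)
  have pairs: "D ` ?V = {P. P \<subseteq> S \<and> card P = 2}"
  proof (rule card_seteq)
    show "finite {P. P \<subseteq> S \<and> card P = 2}" using finS by (auto intro: finite_subset[of _ "Pow S"])
    show "D ` ?V \<subseteq> {P. P \<subseteq> S \<and> card P = 2}" using D by auto
    show "card {P. P \<subseteq> S \<and> card P = 2} \<le> card (D ` ?V)"
      using n_subsets[OF finS] S n card_image[OF D(2)] by (simp add: choose_two)
  qed
  have nn: "non_neighbours H (h s) = h ` D s" if s: "s \<in> S" for s
  proof -
    have "non_neighbours H (h s) = h ` {t \<in> S. h t \<noteq> h s \<and> (h s, h t) \<notin> parcs H}"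
      unfolding non_neighbours_def himg[symmetric] by auto
    also have "{t \<in> S. h t \<noteq> h s \<and> (h s, h t) \<notin> parcs H} = D s"
    proof (intro set_eqI)
      fix t
      have "D s \<subseteq> S" using D(1)[of s] s S(1) by blast
      then show "t \<in> {t \<in> S. h t \<noteq> h s \<and> (h s, h t) \<notin> parcs H} \<longleftrightarrow> t \<in> D s"
        using h(3)[OF s, of t] SS(1)[OF s, of t] SS(2)[OF s] inj_on_eq_iff[OF hinj, of t s] s by auto
    qed
    finally show ?thesis .
  qed
  have R: "remaining_pairs H = (\<lambda>v. h ` D v) ` ?I"
  proof -
    have "{P. P \<subseteq> pverts H \<and> card P = 2} = image h ` {P. P \<subseteq> S \<and> card P = 2}"
    proof (intro equalityI subsetI)
      fix P assume "P \<in> {P. P \<subseteq> pverts H \<and> card P = 2}"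
      then obtain Q where Q: "Q \<subseteq> S" "P = h ` Q" "card P = 2"
        unfolding himg[symmetric] by (auto simp: subset_image_iff)
      then have "card Q = 2" using card_image[of h Q] hinj inj_on_subset by metis
      then show "P \<in> image h ` {P. P \<subseteq> S \<and> card P = 2}" using Q by blast
    next
      fix P assume "P \<in> image h ` {P. P \<subseteq> S \<and> card P = 2}"
      then obtain Q where Q: "Q \<subseteq> S" "P = h ` Q" "card Q = 2" by blast
      then have "card P = 2" using card_image[of h Q] hinj inj_on_subset by metis
      then show "P \<in> {P. P \<subseteq> pverts H \<and> card P = 2}" using Q himg by blast
    qed
    also have "\<dots> = (\<lambda>v. h ` D v) ` ?V" unfolding pairs[symmetric] image_image ..
    finally have all: "{P. P \<subseteq> pverts H \<and> card P = 2} = (\<lambda>v. h ` D v) ` ?V" .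
    have nn': "non_neighbours H ` pverts H = (\<lambda>v. h ` D v) ` S"
      unfolding himg[symmetric] image_image using nn by (intro image_cong) auto
    have "inj_on (\<lambda>v. h ` D v) ?V"
    proof (rule inj_onI)
      fix u v assume "u \<in> ?V" "v \<in> ?V" "h ` D u = h ` D v"
      then show "u = v" using heq[of "D u" "D v"] D by (auto dest: inj_onD)
    qed
    then show ?thesis
      unfolding remaining_pairs_def all nn' using S(1) by (simp add: inj_on_image_set_diff)
  qed
  define k where "k v = (if v \<in> S then Inl (h v) else Inr (h ` D v))" for v
  have kS: "k v = Inl (h v)" if "v \<in> S" for v using that by (simp add: k_def)
  have kI: "k v = Inr (h ` D v)" if "v \<in> ?I" for v using that by (simp add: k_def)
  let ?X = "{(Inl s, Inr P) | s P. P \<in> remaining_pairs H \<and> s \<in> pverts H - P}"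
  have parcs: "parcs (graph_B H) = {(Inl s, Inl t) | s t. (s, t) \<in> parcs H} \<union> ?X \<union> ?X\<inverse>"
    by (simp add: graph_B_def Let_def)
  have X: "(k s, k v) \<in> ?X" if "s \<in> S" "v \<in> ?I" "(s, v) \<in> E" for s v
    using that SI[of s v] hmem[of s "D v"] D(1)[of v] himg kS kI R by auto
  show ?thesis
  proof (rule digraph_iso_pairI)
    show "inj_on k ?V"
    proof (rule inj_onI)
      fix u v assume uv: "u \<in> ?V" "v \<in> ?V" "k u = k v"
      show "u = v"
      proof (cases "u \<in> S")
        case True
        then show ?thesis using uv hinj by (auto simp: k_def inj_on_eq_iff split: if_splits)
      next
        case False
        then have "h ` D u = h ` D v" using uv by (auto simp: k_def split: if_splits)
        then show ?thesis using heq[of "D u" "D v"] D uv by (auto dest: inj_onD)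
      qed
    qed
    have "k ` S = Inl ` pverts H" using kS by (simp add: himg[symmetric] image_image)
    moreover have "k ` ?I = Inr ` remaining_pairs H" unfolding R using kI by (simp add: image_image)
    moreover have "k ` ?V = k ` S \<union> k ` ?I" using S(1) by blast
    ultimately show "k ` ?V = pverts (graph_B H)" by (simp add: graph_B_def Let_def)
    show "map_prod k k ` E = parcs (graph_B H)"
    proof
      show "map_prod k k ` E \<subseteq> parcs (graph_B H)"
      proof
        fix z assume "z \<in> map_prod k k ` E"
        then obtain u v where uv: "(u, v) \<in> E" and z: "z = (k u, k v)" by auto
        then have V: "u \<in> ?V" "v \<in> ?V" using E_verts by auto
        have vu: "(v, u) \<in> E" using uv sym_E by (auto simp: sym_def)
        consider "u \<in> S" "v \<in> S" | "u \<in> S" "v \<in> ?I" | "u \<in> ?I" "v \<in> S" using V II uv by blast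
        then have "(k u, k v) \<in> parcs (graph_B H)"
        proof cases
          case 1
          then show ?thesis using uv h(3)[of u v] kS unfolding parcs by auto
        next
          case 2
          then show ?thesis using X[of u v] uv unfolding parcs by blast
        next
          case 3
          then show ?thesis using X[of v u] vu unfolding parcs by blast
        qed
        then show "z \<in> parcs (graph_B H)" using z by simp
      qed
      have lift: "\<exists>u v. (u, v) \<in> E \<and> a = k u \<and> b = k v" if abX: "(a, b) \<in> ?X" for a b
      proof -
        obtain s P where sP: "a = Inl s" "b = Inr P" "P \<in> remaining_pairs H" "s \<in> pverts H" "s \<notin> P"
          using abX by blast
        obtain u where u: "u \<in> S" "s = h u" using sP(4) himg by blast
        obtain v where v: "v \<in> ?I" "P = h ` D v" using sP(3) R by blast
        have "u \<notin> D v" using sP(5) u v by blast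
        then have "(u, v) \<in> E" using SI u v by blast
        moreover have "a = k u" "b = k v" using u v sP kS kI by simp_all
        ultimately show ?thesis by blast
      qed
      show "parcs (graph_B H) \<subseteq> map_prod k k ` E"
      proof
        fix z assume z: "z \<in> parcs (graph_B H)"
        obtain a b where ab: "z = (a, b)" by (cases z)
        then have "(a, b) \<in> parcs (graph_B H)" using z by simp
        then consider (SS) s t where "a = Inl s" "b = Inl t" "(s, t) \<in> parcs H"
          | (SI) "(a, b) \<in> ?X" | (IS) "(b, a) \<in> ?X" unfolding parcs by blast
        then have "\<exists>u v. (u, v) \<in> E \<and> a = k u \<and> b = k v"
        proof cases
          case SS
          then obtain u v where "u \<in> S" "v \<in> S" "s = h u" "t = h v" using h(2) himg by blast
          then show ?thesis using SS h(3)[of u v] kS by metis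
        next
          case SI
          then show ?thesis by (rule lift)
        next
          case IS
          then obtain u v where "(u, v) \<in> E" "b = k u" "a = k v" using lift by blast
          then show ?thesis using sym_E by (metis symE)
        qed
        then show "z \<in> map_prod k k ` E" using ab by force
      qed
    qed
  qed
qed

end

text \<open>\<open>M\<close> describes the complement on \<open>S\<close>, a 2-regular graph on six
  vertices: two triangles, with complement \<open>K33\<close>, or a hexagon, with complement
  \<open>prism\<close>.\<close>

lemma two_regular_six:
  fixes M :: "'a \<Rightarrow> 'a set"
  assumes S: "card S = 6" and M: "\<And>s. s \<in> S \<Longrightarrow> M s \<subseteq> S - {s}" "\<And>s. s \<in> S \<Longrightarrow> card (M s) = 2"
    and sym: "\<And>s t. s \<in> S \<Longrightarrow> t \<in> M s \<Longrightarrow> s \<in> M t" and inj: "inj_on M S"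
  obtains h :: "'a \<Rightarrow> nat" and H where "H = K33 \<or> H = prism" "bij_betw h S (pverts H)"
    "\<And>s t. s \<in> S \<Longrightarrow> t \<in> S \<Longrightarrow> (h s, h t) \<in> parcs H \<longleftrightarrow> s \<noteq> t \<and> t \<notin> M s"
proof -
  have finS: "finite S" using S by (simp add: card_ge_0_finite)
  have Meq: "M s = {x, y}" if "s \<in> S" "x \<in> M s" "y \<in> M s" "x \<noteq> y" for s x y
  proof -
    have "finite (M s)" using M(1)[OF that(1)] finS finite_subset by blast
    then show ?thesis using card_seteq[of "M s" "{x, y}"] M(2)[OF that(1)] that by simp
  qed
  have Msub: "M s = {x, y}" if "s \<in> S" "M s \<subseteq> {x, y}" for s x y
    using card_seteq[of "{x, y}" "M s"] M(2)[OF that(1)] that by (simp add: card_insert_if)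
  have Mobt: "\<exists>y. y \<noteq> x \<and> M s = {x, y}" if "s \<in> S" "x \<in> M s" for s x
  proof -
    have "\<not> M s \<subseteq> {x}" using M(2)[OF that(1)] card_mono[of "{x}" "M s"] by auto
    then obtain y where "y \<in> M s" "y \<noteq> x" by blast
    then show ?thesis using Meq that by blast
  qed
  obtain a where a: "a \<in> S" using S by fastforce
  obtain b c where bc: "M a = {b, c}" "b \<noteq> c" using M(2)[OF a] by (auto simp: card_2_iff)
  have abc: "b \<in> S" "c \<in> S" "b \<noteq> a" "c \<noteq> a" using M(1)[OF a] bc by auto
  have ab: "a \<in> M b" and ac: "a \<in> M c" using sym[OF a] bc by auto
  show ?thesis
  proof (cases "c \<in> M b")
    case True
    then have Mb: "M b = {a, c}" using Meq[OF abc(1) ab True] abc by simp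
    have "b \<in> M c" using sym[OF abc(1)] True by simp
    then have Mc: "M c = {a, b}" using Meq[OF abc(2) ac] abc by simp
    have "card (S - {a, b, c}) = 3" using S a abc bc finS by (subst card_Diff_subset) auto
    then obtain d e g where deg: "S - {a, b, c} = {d, e, g}" "d \<noteq> e" "d \<noteq> g" "e \<noteq> g"
      by (auto simp: card_3_iff)
    have Seq: "S = {a, b, c, d, e, g}" using deg a abc by blast
    have ne: "distinct [a, b, c, d, e, g]" using deg abc bc(2) by auto
    have rest: "M t \<subseteq> {d, e, g} - {t}" if t: "t \<in> {d, e, g}" for t
    proof -
      have tS: "t \<in> S" using t Seq by blast
      have "t \<notin> M a" "t \<notin> M b" "t \<notin> M c" using bc(1) Mb Mc t ne by auto
      then have "a \<notin> M t" "b \<notin> M t" "c \<notin> M t" using sym[OF tS] by blast+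
      then show ?thesis using M(1)[OF tS] Seq by blast
    qed
    have dS: "d \<in> S" "e \<in> S" "g \<in> S" using Seq by auto
    have Md: "M d = {e, g}" using rest[of d] ne by (intro Msub[OF dS(1)]) auto
    have Me: "M e = {d, g}" using rest[of e] ne by (intro Msub[OF dS(2)]) auto
    have Mg: "M g = {d, e}" using rest[of g] ne by (intro Msub[OF dS(3)]) auto
    define h :: "'a \<Rightarrow> nat" where "h t = (if t = a then 0 else if t = b then 1 else if t = c then 2 else
      if t = d then 3 else if t = e then 4 else 5)" for t
    have h: "h a = 0" "h b = 1" "h c = 2" "h d = 3" "h e = 4" "h g = 5"
      using ne by (auto simp: h_def)
    have six: "{0..<6} = {0::nat, 1, 2, 3, 4, 5}" by auto
    have "bij_betw h S (pverts K33)"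
      unfolding bij_betw_def Seq K33_def by (auto simp: h six)
    moreover have "\<forall>s\<in>S. \<forall>t\<in>S. (h s, h t) \<in> parcs K33 \<longleftrightarrow> s \<noteq> t \<and> t \<notin> M s"
      using ne unfolding Seq by (auto simp: K33_def h bc(1) Mb Mc Md Me Mg)
    ultimately show ?thesis using that by blast
  next
    case False
    obtain d where d: "d \<noteq> a" "M b = {a, d}" using Mobt[OF abc(1) ab] by blast
    obtain e where e: "e \<noteq> a" "M c = {a, e}" using Mobt[OF abc(2) ac] by blast
    have dS: "d \<in> S" "d \<noteq> b" "e \<in> S" "e \<noteq> c" using M(1)[OF abc(1)] M(1)[OF abc(2)] d e by auto
    have dc: "d \<noteq> c" using False d by auto
    have eb: "e \<noteq> b" using sym[OF abc(2), of b] e False by auto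
    have bd: "b \<in> M d" and ce: "c \<in> M e" using sym[OF abc(1)] sym[OF abc(2)] d e by auto
    \<comment> \<open>Equality would close a 4-cycle, whose opposite vertices \<open>a\<close> and
      \<open>d\<close> have the same two neighbours.\<close>
    have de: "d \<noteq> e"
    proof
      assume "d = e"
      then have "M d = M a" using Meq[OF dS(1) bd] ce bc by simp
      then show False using inj a dS d by (auto dest: inj_onD)
    qed
    have "card (S - {a, b, c, d, e}) = 1"
      using S a abc bc finS dS d e dc eb de by (subst card_Diff_subset) auto
    then obtain g where g: "S - {a, b, c, d, e} = {g}" using card_1_singletonE by blast
    have Seq: "S = {a, b, c, d, e, g}" using g a abc dS by blast
    have ne: "distinct [a, b, c, d, e, g]" using g abc bc(2) dS d e dc eb de by auto
    have gS: "g \<in> S" using Seq by simp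
    have "g \<notin> M a" "g \<notin> M b" "g \<notin> M c" using bc(1) d e ne by auto
    then have "a \<notin> M g" "b \<notin> M g" "c \<notin> M g" using sym[OF gS] by blast+
    then have Mg: "M g = {d, e}" using M(1)[OF gS] Seq by (intro Msub[OF gS]) auto
    then have "g \<in> M d" "g \<in> M e" using sym[OF gS] by auto
    then have Md: "M d = {b, g}" and Me: "M e = {c, g}"
      using Meq[OF dS(1) bd] Meq[OF dS(3) ce] ne by auto
    \<comment> \<open>The hexagon runs through \<open>a\<close>, \<open>b\<close>, \<open>d\<close>,
      \<open>g\<close>, \<open>e\<close>, \<open>c\<close>.\<close>
    define h :: "'a \<Rightarrow> nat" where "h t = (if t = a then 0 else if t = b then 1 else if t = d then 2 else
      if t = g then 3 else if t = e then 4 else 5)" for t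
    have h: "h a = 0" "h b = 1" "h d = 2" "h g = 3" "h e = 4" "h c = 5"
      using ne by (auto simp: h_def)
    have six: "{0..<6} = {0::nat, 1, 2, 3, 4, 5}" by auto
    have "bij_betw h S (pverts prism)"
      unfolding bij_betw_def Seq prism_def by (auto simp: h six)
    moreover have "\<forall>s\<in>S. \<forall>t\<in>S. (h s, h t) \<in> parcs prism \<longleftrightarrow> s \<noteq> t \<and> t \<notin> M s"
      using ne unfolding Seq by (auto simp: prism_def h bc(1) d(2) e(2) Md Me Mg)
    ultimately show ?thesis using that by blast
  qed
qed

context graph begin

section \<open>From deficient cuts to the theorem\<close>

lemma critical_cut_exists:
  assumes "gamma_vertex_critical 3 G" "S \<subseteq> verts G"
  shows "\<exists>D. critical_cut (verts G) S non_adj D (reach_class E (verts G - S))"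
proof -
  obtain D where D: "\<And>v. v \<in> verts G \<Longrightarrow> D v \<subseteq> verts G \<and> card (D v) = 2 \<and>
      (\<forall>x\<in>D v. \<forall>y\<in>D v. x \<noteq> y \<longrightarrow> non_adj x \<inter> non_adj y = {v})"
    using critical_pair[OF assms(1)] by metis
  have "critical_cut (verts G) S non_adj D (reach_class E (verts G - S))"
  proof
    show "finite (verts G)" "S \<subseteq> verts G" using assms by simp_all
    show "non_adj x \<subseteq> verts G - {x}" for x by (auto simp: non_adj_def)
    show "x \<in> non_adj y" if "x \<in> verts G" "y \<in> non_adj x" for x y
      using that sym_E by (auto simp: non_adj_def sym_def)
    show "D v \<subseteq> verts G" "card (D v) = 2" if "v \<in> verts G" for v using D[OF that] by simp_all
    show "non_adj x \<inter> non_adj y = {v}" if "v \<in> verts G" "x \<in> D v" "y \<in> D v" "x \<noteq> y" for v x y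
      using D[OF that(1)] that by blast
    show "y \<in> non_adj x" if "x \<in> verts G - S" "y \<in> verts G - S"
      "reach_class E (verts G - S) x \<noteq> reach_class E (verts G - S) y" for x y
    proof -
      have "(x, y) \<notin> E" using reach_class_edge[OF _ that(1,2) sym_E] that(3) by blast
      moreover have "x \<noteq> y" using that(3) by blast
      ultimately show ?thesis using that(2) by (simp add: non_adj_def)
    qed
  qed
  then show ?thesis by blast
qed

text \<open>Otherwise \<open>x\<close> has neighbours in \<open>p + 1\<close> components, and one
  from each gives an induced star, as there are no edges between components.\<close>

lemma missed_classes:
  assumes free: "star_free (Suc p) G" and S: "S \<subseteq> verts G" and x: "x \<in> S"
  defines "f \<equiv> reach_class E (verts G - S)"
  shows "card (f ` (verts G - S))
    \<le> p + card {k \<in> f ` (verts G - S). \<forall>u\<in>verts G - S. f u = k \<longrightarrow> u \<in> non_adj x}"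
proof (rule ccontr)
  let ?I = "verts G - S"
  let ?M = "{k \<in> f ` ?I. \<forall>u\<in>?I. f u = k \<longrightarrow> u \<in> non_adj x}"
  assume "\<not> ?thesis"
  then have "Suc p \<le> card (f ` ?I) - card ?M" by simp
  also have "\<dots> = card (f ` ?I - ?M)" by (subst card_Diff_subset) auto
  finally obtain K where K: "K \<subseteq> f ` ?I - ?M" "card K = Suc p"
    by (meson obtain_subset_with_card_n)
  have "\<exists>u\<in>?I. f u = k \<and> u \<notin> non_adj x" if "k \<in> K" for k using K that by blast
  then obtain r where r: "\<And>k. k \<in> K \<Longrightarrow> r k \<in> ?I \<and> f (r k) = k \<and> r k \<notin> non_adj x" by metis
  have "inj_on r K" using r by (metis inj_onI)
  then have "card (r ` K) = Suc p" using K by (simp add: card_image)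
  moreover have "card (r ` K) \<noteq> Suc p"
  proof (rule star_free_neighbours[OF free])
    show "x \<in> verts G" using x S by blast
    show "r ` K \<subseteq> {u. (x, u) \<in> E}" using r x by (fastforce simp: non_adj_def)
    show "(u, w) \<notin> E" if "u \<in> r ` K" "w \<in> r ` K" for u w
    proof
      assume uw: "(u, w) \<in> E"
      have "u \<in> ?I" "w \<in> ?I" "r (f u) = u" "r (f w) = w" using that r by auto
      moreover have "f u = f w" unfolding f_def
        using uw calculation(1,2) sym_E by (rule reach_class_edge)
      ultimately have "u = w" by metis
      then show False using uw irrefl_E by (auto simp: irrefl_def)
    qed
  qed
  ultimately show False by blast
qed

text \<open>\<open>p\<close> encodes both parts: the deficiency \<open>p - 3\<close> is 2 or 3, and
  the forbidden order \<open>p + 7\<close> is 12 or 13.\<close>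

lemma critical_deficient_cut:
  assumes crit: "gamma_vertex_critical 3 G" and p: "p = 5 \<or> p = 6"
    and free: "star_free (Suc p) G" and S: "S \<subseteq> verts G"
    and deficient: "card S + p \<le> card (odd_classes E (verts G - S)) + 3"
    and parity: "p = 5 \<longleftrightarrow> even (card (verts G))" and n: "card (verts G) \<noteq> p + 7"
    and empty: "p = 6 \<Longrightarrow> S \<noteq> {}"
  shows "p = 6 \<and> (digraph_iso G (with_proj graph_A) \<or> digraph_iso G (with_proj graph_B1) \<or>
           digraph_iso G (with_proj graph_B2))"
proof -
  let ?f = "reach_class E (verts G - S)" and ?I = "verts G - S"
  let ?m = "card (?f ` ?I)"
  obtain D where "critical_cut (verts G) S non_adj D ?f" using critical_cut_exists[OF crit S] by blast
  then interpret critical_cut "verts G" S non_adj D ?f .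
  have sub: "odd_classes E ?I \<subseteq> ?f ` ?I" by (auto simp: odd_classes_def)
  then have "card (odd_classes E ?I) \<le> ?m" by (intro card_mono) auto
  then have m: "card S + p \<le> ?m + 3" using deficient by simp
  \<comment> \<open>When the lower bound on the number of components is attained, there is no even
    component besides the odd ones.\<close>
  have all_odd: "odd (card {u \<in> ?I. ?f u = k})" if tight: "?m + 3 = card S + p" "k \<in> ?f ` ?I" for k
  proof -
    have "odd_classes E ?I = ?f ` ?I" using sub deficient tight(1) by (intro card_seteq) auto
    then have "odd (card k)" using tight(2) by (auto simp: odd_classes_def)
    moreover obtain v where v: "v \<in> ?I" "k = ?f v" using tight(2) by blast
    have "{u \<in> ?I. ?f u = k} = k"
    proof (intro equalityI subsetI)
      fix u assume "u \<in> {u \<in> ?I. ?f u = k}"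
      then show "u \<in> k" using reach_class_refl[of u ?I E] by auto
    next
      fix u assume u: "u \<in> k"
      then have "u \<in> ?I" using v by (simp add: reach_class_def)
      moreover have "?f u = k" using reach_class_eq[OF sym_E, of u ?I v] u v by simp
      ultimately show "u \<in> {u \<in> ?I. ?f u = k}" by simp
    qed
    ultimately show ?thesis by simp
  qed
  have star: "?m \<le> p + card (missed x)" if "x \<in> S" for x
    using missed_classes[OF free S that] by (simp add: missed_def)
  have edge: "(s, t) \<in> E \<longleftrightarrow> s \<noteq> t \<and> t \<notin> non_adj s" if "t \<in> verts G" for s t
    using that irrefl_E by (auto simp: non_adj_def irrefl_def)
  consider "card S = 0" | "card S = 1" | "card S = 2" | "card S = 3" | "card S = 4" | "card S = 5"
    | "card S \<ge> 6" by linarith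
  then show ?thesis
  proof cases
    case 1
    then have S0: "S = {}" using finS by simp
    then have p5: "p = 5" using p empty by blast
    then have "?m \<ge> 2" using m 1 by simp
    moreover have "odd (card {u \<in> ?I. ?f u = k})" if "?m = 2" "k \<in> ?f ` ?I" for k
      using all_odd that 1 p5 by simp
    ultimately show ?thesis using cut_empty[OF S0] parity p5 by blast
  next
    case 2
    then show ?thesis using cut_size_one m p by auto
  next
    case 3
    then show ?thesis using cut_size_two m p by auto
  next
    case 4
    have m5: "?m \<ge> 5" using m p 4 by auto
    show ?thesis
    proof (cases "p = 5")
      case True
      then show ?thesis using cut_size_three[OF 4 m5] parity by auto
    next
      case False
      then have p6: "p = 6" using p by simp
      then have m6: "?m \<ge> 6" using m 4 by simp
      then have A: "card (verts G) = 9" "\<forall>a\<in>S. S - {a} \<subseteq> non_adj a" "\<forall>x\<in>S. card (Nout x) = 2"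
        "\<forall>x\<in>S. \<forall>y\<in>S. x \<noteq> y \<longrightarrow> Nout x \<inter> Nout y = {}" "?I = (\<Union>x\<in>S. Nout x)"
        using cut_size_three[OF 4 m5] by simp_all
      have "card ?I = 6" using card_V A(1) 4 by simp
      \<comment> \<open>There are as many components as vertices outside \<open>S\<close>, so each
        is a single vertex and \<open>?I\<close> is independent.\<close>
      then have inj: "inj_on ?f ?I" using m6 card_image_le[OF finI, of ?f] by (intro eq_card_imp_inj_on) simp_all
      have "digraph_iso G (with_proj graph_A)"
      proof (rule iso_graph_A[where w = Nout])
        show "(s, t) \<notin> E" if "s \<in> S" "t \<in> S" for s t
        proof -
          have "t \<in> verts G" "s \<noteq> t \<Longrightarrow> t \<in> non_adj s" using A(2) that S by auto
          then show ?thesis using edge[of t s] by metis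
        qed
        show "(s, t) \<notin> E" if "s \<in> ?I" "t \<in> ?I" for s t
          using edge[of t s] sep[of s t] inj that by (auto dest: inj_onD)
        show "(s, t) \<in> E \<longleftrightarrow> t \<notin> Nout s" if "s \<in> S" "t \<in> ?I" for s t
          using edge[of t s] that by (auto simp: Nout_def)
      qed (use A S 4 in auto)
      then show ?thesis using p6 by blast
    qed
  next
    case 5
    have "\<exists>k\<in>?f ` ?I. \<forall>u\<in>?I. ?f u = k \<longrightarrow> u \<in> non_adj x" if "x \<in> S" for x
    proof -
      have "card (missed x) \<noteq> 0" using star[OF that] m 5 by simp
      then have "missed x \<noteq> {}" by auto
      then show ?thesis unfolding missed_def by blast
    qed
    moreover have "?m \<ge> 6" using m p 5 by auto
    ultimately show ?thesis using cut_size_four[OF 5] by blast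
  next
    case 6
    have "False"
    proof (rule cut_size_five[OF 6, of p])
      show "odd (card {u \<in> ?I. ?f u = k})" if "?m = p + 2" "k \<in> ?f ` ?I" for k
        using all_odd that 6 by simp
    qed (use p m 6 star n in auto)
    then show ?thesis ..
  next
    case 7
    have B: "p = 6" "card S = 6" "card (verts G) = 15" "?m = 9" "\<And>v. v \<in> verts G \<Longrightarrow> non_adj v \<inter> S = D v"
      using cut_size_ge_six[OF 7 p _ star] m parity by auto
    have "card ?I = 9" using card_V B by simp
    then have inj: "inj_on ?f ?I" using B(4) by (intro eq_card_imp_inj_on) simp_all
    have DS: "D v \<subseteq> S" if "v \<in> verts G" for v using B(5)[OF that] by blast
    have SS: "(s, t) \<in> E \<longleftrightarrow> s \<noteq> t \<and> t \<notin> D s" if "s \<in> S" "t \<in> S" for s t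
      using edge[of t s] B(5)[of s] that S by blast
    have nself: "s \<notin> D s" if "s \<in> S" for s using D_irrefl that S by blast
    have symD: "s \<in> D t" if "s \<in> S" "t \<in> D s" for s t
    proof -
      have "s \<in> verts G" "t \<in> verts G" "t \<in> non_adj s" using that S D_sub B(5)[of s] by blast+
      then show ?thesis using N_sym B(5)[of t] that(1) by blast
    qed
    obtain h :: "'a \<Rightarrow> nat" and H where H: "H = K33 \<or> H = prism" "bij_betw h S (pverts H)"
      "\<And>s t. s \<in> S \<Longrightarrow> t \<in> S \<Longrightarrow> (h s, h t) \<in> parcs H \<longleftrightarrow> s \<noteq> t \<and> t \<notin> D s"
    proof (rule two_regular_six[OF B(2), of D])
      show "D s \<subseteq> S - {s}" if "s \<in> S" for s using DS nself that S by blast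
      show "card (D s) = 2" if "s \<in> S" for s using D_card that S by blast
      show "inj_on D S" using D_inj S by (rule inj_on_subset)
    qed (use symD in blast)+
    have "digraph_iso G (with_proj (graph_B H))"
    proof (rule iso_graph_B[OF S B(2,3) _ D_inj SS nself _ _ H(2)])
      show "D v \<subseteq> S \<and> card (D v) = 2" if "v \<in> verts G" for v using DS D_card that by blast
      show "(s, t) \<notin> E" if "s \<in> ?I" "t \<in> ?I" for s t
        using edge[of t s] sep[of s t] inj that by (auto dest: inj_onD)
      show "(s, t) \<in> E \<longleftrightarrow> s \<notin> D t" if "s \<in> S" "t \<in> ?I" for s t
      proof -
        have "s \<in> D t \<longleftrightarrow> s \<in> non_adj t" using B(5)[of t] that by blast
        also have "\<dots> \<longleftrightarrow> t \<in> non_adj s" using N_sym[of s t] N_sym[of t s] that S by blast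
        finally show ?thesis using edge[of t s] that by blast
      qed
      show "parcs H \<subseteq> pverts H \<times> pverts H" using H(1) by (auto simp: K33_def prism_def)
      show "(h s, h t) \<in> parcs H \<longleftrightarrow> (s, t) \<in> E" if "s \<in> S" "t \<in> S" for s t
        using H(3) SS that by blast
    qed
    then show ?thesis using H(1) B(1) by (auto simp: graph_B1_def graph_B2_def)
  qed
qed

end

theorem theorem1p4:
  fixes G :: "('a, 'b) pre_digraph"
  assumes "graph G"
    and "gamma_vertex_critical 3 G"
  shows "(star_free 6 G \<and> even (card (verts G)) \<and> card (verts G) \<noteq> 12
            \<longrightarrow> (\<exists>M. perfect_matching G M))
       \<and> (star_free 7 G \<and> odd (card (verts G)) \<and> num_odd_components G = 1 \<and> card (verts G) \<noteq> 13
            \<longrightarrow> (\<exists>M. near_perfect_matching G M)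
                \<or> digraph_iso G (with_proj graph_A)
                \<or> digraph_iso G (with_proj graph_B1)
                \<or> digraph_iso G (with_proj graph_B2))"
proof (intro conjI impI; elim conjE)
  interpret graph G by fact
  assume *: "star_free 6 G" "even (card (verts G))" "card (verts G) \<noteq> 12"
  show "\<exists>M. perfect_matching G M"
  proof (rule ccontr)
    assume "\<not> ?thesis"
    with *(2) obtain S where S: "S \<subseteq> verts G" "card S + 2 \<le> card (odd_classes (arcs_ends G) (verts G - S))"
      by (rule no_perfect_matching)
    then show False using critical_deficient_cut[OF assms(2), of 5 S] * S by simp
  qed
next
  interpret graph G by fact
  assume *: "star_free 7 G" "odd (card (verts G))" "num_odd_components G = 1" "card (verts G) \<noteq> 13"
  show "(\<exists>M. near_perfect_matching G M) \<or> digraph_iso G (with_proj graph_A)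
      \<or> digraph_iso G (with_proj graph_B1) \<or> digraph_iso G (with_proj graph_B2)"
  proof (cases "\<exists>M. near_perfect_matching G M")
    case False
    with *(2) obtain S where S: "S \<subseteq> verts G" "card S + 3 \<le> card (odd_classes (arcs_ends G) (verts G - S))"
      by (rule no_near_perfect_matching)
    \<comment> \<open>For the empty cut the graph itself would have three odd components.\<close>
    have "S \<noteq> {}" using S(2) card_odd_classes_le *(3) by auto
    then show ?thesis using critical_deficient_cut[OF assms(2), of 6 S] * S by simp
  qed blast
qed

end
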